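(* Let $\Gamma$ be a non-elementary hyperbolic group with a finite symmetric generating set $\mathcal S$. Then there exist a semigroup $S\subset\Gamma$, a finite set $F\subset\Gamma$ and mappings $L,R:\Gamma\to F$ with the following properties: (1) $S$ generates $\Gamma$ as a group; (2) $S$ is quasi-geodesic; and (3) $L(\gamma)\,\gamma\,R(\gamma)\in S$ for all $\gamma\in\Gamma$.
   Context: $|\gamma|$ is the word length of $\gamma\in\Gamma$ with respect to $\mathcal S$ and $\mathrm{dist}(\gamma,\eta)=|\gamma^{-1}\eta|$. Non-elementary means that $\Gamma$ contains two independent loxodromic elements. Given $C,D>0$, a $(C,D)$-quasi-geodesic is a sequence $x:I\cap\mathbb Z\to\Gamma$, with $I$ an interval, such that $C^{-1}|m-n|-D\le\mathrm{dist}(x_m,x_n)\le C|m-n|+D$ for all $m,n\in I\cap\mathbb Z$. A semigroup $S\subset\Gamma$ is quasi-geodesic if there exist constants $C,D>0$ such that for all $n$ and all $\gamma_1,\dots,\gamma_n\in S$ the sequence $e,\gamma_1,\gamma_1\gamma_2,\dots,\gamma_1\cdots\gamma_n$ is visited in left to right order by some $(C,D)$-quasi-geodesic. *)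

theory Defs
  imports "HOL-Algebra.Generated_Groups" "HOL-Analysis.Topology_Euclidean_Space"
begin

definition finite_symmetric_generating_set :: "('a, 'b) monoid_scheme \<Rightarrow> 'a set \<Rightarrow> bool"
  where "finite_symmetric_generating_set G S \<longleftrightarrow>
    finite S \<and> S \<subseteq> carrier G \<and> (\<forall>s\<in>S. inv\<^bsub>G\<^esub> s \<in> S) \<and> generate G S = carrier G"

definition list_product :: "('a, 'b) monoid_scheme \<Rightarrow> 'a list \<Rightarrow> 'a"
  where "list_product G ws = foldr (mult G) ws \<one>\<^bsub>G\<^esub>"

definition word_length :: "('a, 'b) monoid_scheme \<Rightarrow> 'a set \<Rightarrow> 'a \<Rightarrow> nat"
  where "word_length G S g = (LEAST n. \<exists>ws. set ws \<subseteq> S \<and> length ws = n \<and> list_product G ws = g)"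

definition word_dist :: "('a, 'b) monoid_scheme \<Rightarrow> 'a set \<Rightarrow> 'a \<Rightarrow> 'a \<Rightarrow> real"
  where "word_dist G S g h = real (word_length G S (inv\<^bsub>G\<^esub> g \<otimes>\<^bsub>G\<^esub> h))"


subsection \<open>Hyperbolicity\<close>

text \<open>The Gromov product \<open>(x | y)\<^sub>p\<close> with base point \<open>p\<close>.\<close>

definition gromov_product ::
    "('a, 'b) monoid_scheme \<Rightarrow> 'a set \<Rightarrow> 'a \<Rightarrow> 'a \<Rightarrow> 'a \<Rightarrow> real"
  where "gromov_product G S p x y =
    (word_dist G S x p + word_dist G S y p - word_dist G S x y) / 2"

text \<open>Gromov's definition of hyperbolicity, for the word metric of the given generating set.\<close>

definition hyperbolic :: "('a, 'b) monoid_scheme \<Rightarrow> 'a set \<Rightarrow> bool"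
  where "hyperbolic G S \<longleftrightarrow>
    (\<exists>\<delta>\<ge>0. \<forall>p\<in>carrier G. \<forall>x\<in>carrier G. \<forall>y\<in>carrier G. \<forall>z\<in>carrier G.
       gromov_product G S p x z \<ge>
         min (gromov_product G S p x y) (gromov_product G S p y z) - \<delta>)"


subsection \<open>Quasi-geodesics and loxodromic elements\<close>

text \<open>A sequence defined on \<open>I \<inter> \<int>\<close> is represented by a total function on the integers of
  which only the values at integers lying in the real interval \<open>I\<close> matter.\<close>

definition quasi_geodesic ::
    "('a, 'b) monoid_scheme \<Rightarrow> 'a set \<Rightarrow> real \<Rightarrow> real \<Rightarrow> real set \<Rightarrow> (int \<Rightarrow> 'a) \<Rightarrow> bool"
  where "quasi_geodesic G S C D I x \<longleftrightarrow>
    is_interval I \<and>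
    (\<forall>m. of_int m \<in> I \<longrightarrow> x m \<in> carrier G) \<and>
    (\<forall>m n. of_int m \<in> I \<longrightarrow> of_int n \<in> I \<longrightarrow>
       inverse C * of_int \<bar>m - n\<bar> - D \<le> word_dist G S (x m) (x n) \<and>
       word_dist G S (x m) (x n) \<le> C * of_int \<bar>m - n\<bar> + D)"

definition loxodromic :: "('a, 'b) monoid_scheme \<Rightarrow> 'a set \<Rightarrow> 'a \<Rightarrow> bool"
  where "loxodromic G S g \<longleftrightarrow>
    g \<in> carrier G \<and> (\<exists>C>0. \<exists>D>0. quasi_geodesic G S C D UNIV (\<lambda>n. g [^]\<^bsub>G\<^esub> n))"


subsection \<open>The Gromov boundary\<close>

text \<open>Points of the boundary are classes of sequences \<open>x\<close> with \<open>(x\<^sub>m | x\<^sub>n) \<rightarrow> \<infinity>\<close> as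
  \<open>m, n \<rightarrow> \<infinity>\<close>, two sequences \<open>x\<close> and \<open>y\<close> being equivalent when \<open>(x\<^sub>n | y\<^sub>n) \<rightarrow> \<infinity>\<close>. The base
  point is the identity. Left multiplication is isometric for the word metric and so acts on
  the boundary, termwise on the representing sequences.\<close>

definition gromov_sequences :: "('a, 'b) monoid_scheme \<Rightarrow> 'a set \<Rightarrow> (nat \<Rightarrow> 'a) set"
  where "gromov_sequences G S =
    {x. range x \<subseteq> carrier G \<and>
        filterlim (\<lambda>(m, n). gromov_product G S \<one>\<^bsub>G\<^esub> (x m) (x n)) at_top
          (sequentially \<times>\<^sub>F sequentially)}"

definition gromov_equivalence ::
    "('a, 'b) monoid_scheme \<Rightarrow> 'a set \<Rightarrow> ((nat \<Rightarrow> 'a) \<times> (nat \<Rightarrow> 'a)) set"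
  where "gromov_equivalence G S =
    {(x, y). x \<in> gromov_sequences G S \<and> y \<in> gromov_sequences G S \<and>
       filterlim (\<lambda>n. gromov_product G S \<one>\<^bsub>G\<^esub> (x n) (y n)) at_top sequentially}"

definition gromov_boundary :: "('a, 'b) monoid_scheme \<Rightarrow> 'a set \<Rightarrow> (nat \<Rightarrow> 'a) set set"
  where "gromov_boundary G S = gromov_sequences G S // gromov_equivalence G S"

definition boundary_action ::
    "('a, 'b) monoid_scheme \<Rightarrow> 'a \<Rightarrow> (nat \<Rightarrow> 'a) set \<Rightarrow> (nat \<Rightarrow> 'a) set"
  where "boundary_action G g \<xi> = (\<lambda>x n. g \<otimes>\<^bsub>G\<^esub> x n) ` \<xi>"

definition boundary_fixed_points ::
    "('a, 'b) monoid_scheme \<Rightarrow> 'a set \<Rightarrow> 'a \<Rightarrow> (nat \<Rightarrow> 'a) set set"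
  where "boundary_fixed_points G S g = {\<xi> \<in> gromov_boundary G S. boundary_action G g \<xi> = \<xi>}"

definition independent_loxodromics ::
    "('a, 'b) monoid_scheme \<Rightarrow> 'a set \<Rightarrow> 'a \<Rightarrow> 'a \<Rightarrow> bool"
  where "independent_loxodromics G S g h \<longleftrightarrow>
    loxodromic G S g \<and> loxodromic G S h \<and>
    boundary_fixed_points G S g \<inter> boundary_fixed_points G S h = {}"

definition non_elementary :: "('a, 'b) monoid_scheme \<Rightarrow> 'a set \<Rightarrow> bool"
  where "non_elementary G S \<longleftrightarrow> (\<exists>g h. independent_loxodromics G S g h)"


subsection \<open>Quasi-geodesic semigroups\<close>

definition subsemigroup :: "('a, 'b) monoid_scheme \<Rightarrow> 'a set \<Rightarrow> bool"
  where "subsemigroup G T \<longleftrightarrow> T \<subseteq> carrier G \<and> (\<forall>a\<in>T. \<forall>b\<in>T. a \<otimes>\<^bsub>G\<^esub> b \<in> T)"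

text \<open>The list \<open>gs\<close> is \<open>\<gamma>\<^sub>1, \<dots>, \<gamma>\<^sub>n\<close>, so that \<open>list_product G (take i gs)\<close> is
  \<open>\<gamma>\<^sub>1 \<cdots> \<gamma>\<^sub>i\<close>, which is visited at time \<open>t i\<close>. Visiting times are strictly increasing;
  allowing equal consecutive times would only make a difference in admitting the identity
  as an element of \<open>T\<close>.\<close>

definition quasi_geodesic_semigroup ::
    "('a, 'b) monoid_scheme \<Rightarrow> 'a set \<Rightarrow> 'a set \<Rightarrow> bool"
  where "quasi_geodesic_semigroup G S T \<longleftrightarrow>
    subsemigroup G T \<and>
    (\<exists>C>0. \<exists>D>0. \<forall>gs. set gs \<subseteq> T \<longrightarrow>
       (\<exists>I x t. quasi_geodesic G S C D I x \<and>
          strict_mono_on {..length gs} t \<and>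
          (\<forall>i\<le>length gs. of_int (t i) \<in> I \<and> x (t i) = list_product G (take i gs))))"

end

theory Submission
  imports Defs "HOL-Real_Asymp.Real_Asymp"
begin

text \<open>The proof is a ping-pong argument with one entrance and one exit. Take long powers \<open>a\<close> and
  \<open>b\<close> of two independent loxodromic elements, so that the Gromov product \<open>(a | b)\<close> at the identity
  is small, and let the gate consist of the elements \<open>x\<close> such that \<open>(x | a)\<close> and \<open>(x\<inverse> | b)\<close> are
  large: these start out towards \<open>a\<close>, and seen from their end point the way back starts out
  towards \<open>b\<close>. When two elements of the gate are multiplied, the second one leaves the
  junction towards \<open>a\<close> while the way back points towards \<open>b\<close>, so the geodesics hardly fellow-travel
  there (\<open>gate_junction\<close>). As elements of the gate are long compared with this loss, a product of any
  number of them traces a broken geodesic that is a quasi-geodesic, with constants independent of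
  the number and of the lengths of the factors (\<open>chain_gp\<close>, \<open>chain_length\<close>). The semigroup is the
  one generated by the gate.

  An arbitrary \<open>x\<close> is pushed into the gate by multiplying it on both sides. There are two
  elements \<open>r\<close> of the gate that diverge early and are very long, so one of them has little in
  common with \<open>x\<inverse>\<close>; then \<open>x r\<close> ends like \<open>r\<close>. In the same way one of two elements \<open>l\<close>
  makes \<open>l x r\<close> start like \<open>l\<close> (\<open>gate_sandwich\<close>, \<open>gate_absorbs\<close>). Since \<open>l\<close> and \<open>r\<close> are themselves
  taken from the gate, \<open>x = l\<inverse> (l x r) r\<inverse>\<close> lies in the group generated by the semigroup, so the
  absorption property also gives generation.

  The geometric input about loxodromic elements is elementary. Some power \<open>u\<close> satisfies
  \<open>|u\<^sup>2| > |u| + 3 \<delta>\<close>, and then the argument for broken geodesics, with all steps equal to \<open>u\<close>,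
  shows that \<open>(u\<^sup>n)\<close> converges in the Gromov boundary. Its limit is fixed by the loxodromic element.
  Independence therefore bounds the Gromov products between powers of the two elements, for all
  four choices of signs (\<open>independent_transverse\<close>). As
  all words \<open>l\<close> and \<open>r\<close> alternate between the two elements, these bounds control every junction.\<close>

section \<open>Products of lists\<close>

context group
begin

lemma list_product_simps [simp]:
  "list_product G [] = \<one>" "list_product G (x # xs) = x \<otimes> list_product G xs"
  by (auto simp: list_product_def)

lemma list_product_closed [simp]: "set xs \<subseteq> carrier G \<Longrightarrow> list_product G xs \<in> carrier G"
  by (induction xs) auto

lemma list_product_append:
  "set xs \<subseteq> carrier G \<Longrightarrow> set ys \<subseteq> carrier G \<Longrightarrow>
    list_product G (xs @ ys) = list_product G xs \<otimes> list_product G ys"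
  by (induction xs) (auto simp: m_assoc)

lemma list_product_concat:
  "\<forall>xs\<in>set xss. set xs \<subseteq> carrier G \<Longrightarrow>
    list_product G (concat xss) = list_product G (map (list_product G) xss)"
  by (induction xss) (auto simp: list_product_append UN_subset_iff)

end

section \<open>Gromov products for a hyperbolic length function\<close>

text \<open>The four-point inequality at the identity is enough: a length function gives a
  left-invariant metric, so every base point looks like the identity.\<close>

locale hyperbolic_length = group G for G (structure) +
  fixes len :: "'a \<Rightarrow> real" and \<delta> :: real
  assumes len_one [simp]: "len \<one> = 0"
    and len_inv [simp]: "x \<in> carrier G \<Longrightarrow> len (inv x) = len x"
    and len_mult: "x \<in> carrier G \<Longrightarrow> y \<in> carrier G \<Longrightarrow> len (x \<otimes> y) \<le> len x + len y"
    and delta_nonneg: "0 \<le> \<delta>"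
    and four_point: "\<lbrakk>x \<in> carrier G; y \<in> carrier G; z \<in> carrier G\<rbrakk> \<Longrightarrow>
      min ((len x + len y - len (inv x \<otimes> y)) / 2) ((len y + len z - len (inv y \<otimes> z)) / 2) - \<delta>
        \<le> (len x + len z - len (inv x \<otimes> z)) / 2"
begin

text \<open>The Gromov product based at the identity.\<close>

definition gp :: "'a \<Rightarrow> 'a \<Rightarrow> real"
  where "gp x y = (len x + len y - len (inv x \<otimes> y)) / 2"

lemma gp_hyp:
  "\<lbrakk>x \<in> carrier G; y \<in> carrier G; z \<in> carrier G\<rbrakk> \<Longrightarrow> min (gp x y) (gp y z) - \<delta> \<le> gp x z"
  unfolding gp_def by (rule four_point)

lemma len_nonneg:
  assumes "x \<in> carrier G" shows "0 \<le> len x"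
  using len_mult[of "inv x" x] assms by simp

lemma gp_commute:
  assumes "x \<in> carrier G" "y \<in> carrier G" shows "gp x y = gp y x"
proof -
  have "len (inv x \<otimes> y) = len (inv (inv x \<otimes> y))" using assms by simp
  also have "inv (inv x \<otimes> y) = inv y \<otimes> x" using assms by (simp add: inv_mult_group)
  finally show ?thesis by (simp add: gp_def)
qed

lemma gp_le_len:
  assumes "x \<in> carrier G" "y \<in> carrier G" shows "gp x y \<le> len x"
proof -
  have "len (x \<otimes> (inv x \<otimes> y)) \<le> len x + len (inv x \<otimes> y)" using assms by (intro len_mult) auto
  moreover have "x \<otimes> (inv x \<otimes> y) = y" using assms by (simp add: m_assoc[symmetric])
  ultimately show ?thesis by (simp add: gp_def)
qed

lemma gp_nonneg:
  assumes "x \<in> carrier G" "y \<in> carrier G" shows "0 \<le> gp x y"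
  using len_mult[of "inv x" y] assms by (simp add: gp_def)

lemma gp_self [simp]: "x \<in> carrier G \<Longrightarrow> gp x x = len x"
  by (simp add: gp_def)

lemma gp_one [simp]: "x \<in> carrier G \<Longrightarrow> gp x \<one> = 0"
  by (simp add: gp_def)

lemma len_mult_eq:
  assumes "x \<in> carrier G" "y \<in> carrier G"
  shows "len (x \<otimes> y) = len x + len y - 2 * gp (inv x) y"
  using assms by (simp add: gp_def field_simps)

text \<open>What \<open>x y\<close> shares with \<open>x\<close> is all of \<open>x\<close> except the part cancelled at the junction. This
  converts smallness of a product at the junction into largeness at the identity.\<close>

lemma gp_mult_left:
  assumes "x \<in> carrier G" "y \<in> carrier G"
  shows "gp (x \<otimes> y) x = len x - gp (inv x) y"
proof -
  have "inv (x \<otimes> y) \<otimes> x = inv y" using assms by (simp add: inv_mult_group m_assoc)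
  then show ?thesis using assms by (simp add: gp_def field_simps)
qed

lemma gp_translate:
  assumes "z \<in> carrier G" "x \<in> carrier G" "y \<in> carrier G"
  shows "gp (z \<otimes> x) (z \<otimes> y) \<le> len z + gp x y"
proof -
  have "inv (z \<otimes> x) \<otimes> (z \<otimes> y) = inv x \<otimes> (inv z \<otimes> (z \<otimes> y))"
    using assms by (simp add: inv_mult_group m_assoc)
  also have "inv z \<otimes> (z \<otimes> y) = y" using assms by (simp add: m_assoc[symmetric])
  finally show ?thesis
    using len_mult[of z x] len_mult[of z y] assms by (simp add: gp_def field_simps)
qed

lemma gp_geodesic_mono:
  assumes "v \<in> carrier G" "p \<in> carrier G" "q \<in> carrier G"
    and "len (p \<otimes> q) = len p + len q"
  shows "gp v p \<le> gp v (p \<otimes> q)"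
proof -
  have "len (inv v \<otimes> (p \<otimes> q)) \<le> len (inv v \<otimes> p) + len q"
    using len_mult[of "inv v \<otimes> p" q] assms by (simp add: m_assoc)
  then show ?thesis using assms by (simp add: gp_def)
qed

text \<open>The form in which hyperbolicity is mostly used: if \<open>y\<close> follows \<open>z\<close> for longer than
  \<open>x\<close> does, then \<open>x\<close> leaves \<open>y\<close> about when it leaves \<open>z\<close>.\<close>

lemma gp_separate:
  assumes "x \<in> carrier G" "y \<in> carrier G" "z \<in> carrier G"
    and "gp x z \<le> c" "c + \<delta> < gp z y"
  shows "gp x y \<le> c + \<delta>"
proof -
  have "min (gp x y) (gp y z) - \<delta> \<le> gp x z" by (rule gp_hyp) (use assms in auto)
  then show ?thesis using assms gp_commute[of y z] by (auto simp: min_def split: if_splits)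
qed

section \<open>Broken geodesics\<close>

text \<open>The path with steps \<open>w # ws\<close> never comes back to undo its first step. By induction the rest of
  the path cancels little of the following step \<open>v\<close>; as \<open>v\<close> is long, the rest of the path stays with
  \<open>v\<close> beyond the point where \<open>w\<inverse>\<close> leaves it. The first and the last step may be short, so that the
  estimate also covers subpaths that begin and end inside a step.\<close>

lemma chain_gp:
  assumes "set (w # ws) \<subseteq> carrier G"
    and "successively (\<lambda>x y. gp (inv x) y \<le> c) (w # ws)"
    and "\<forall>v\<in>set (butlast ws). 2 * c + 2 * \<delta> < len v" and "0 \<le> c"
  shows "gp (inv w) (list_product G ws) \<le> c + \<delta>"
  using assms
proof (induction ws arbitrary: w)
  case Nil
  then show ?case using delta_nonneg by simp
next
  case (Cons v vs)
  show ?case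
  proof (cases "vs = []")
    case True
    then show ?thesis using Cons.prems delta_nonneg by simp
  next
    case False
    have IH: "gp (inv v) (list_product G vs) \<le> c + \<delta>"
      using Cons.prems False by (intro Cons.IH) auto
    have "gp v (v \<otimes> list_product G vs) = len v - gp (inv v) (list_product G vs)"
      using Cons.prems by (subst gp_commute) (auto simp: gp_mult_left)
    moreover have "2 * c + 2 * \<delta> < len v" using Cons.prems False by auto
    ultimately have "c + \<delta> < gp v (v \<otimes> list_product G vs)" using IH by linarith
    then show ?thesis using Cons.prems by (auto intro: gp_separate[where z = v])
  qed
qed

text \<open>Each junction costs at most \<open>2 c + 2 \<delta>\<close>, and half of the length of an interior step pays for
  one junction. The remaining constant pays for the last junction.\<close>

lemma chain_length:
  assumes "set (w # ws) \<subseteq> carrier G"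
    and "successively (\<lambda>x y. gp (inv x) y \<le> c) (w # ws)"
    and "\<forall>v\<in>set (butlast ws). 4 * c + 4 * \<delta> < len v" and "0 \<le> c"
  shows "sum_list (map len (w # ws)) / 2 - (2 * c + 2 * \<delta>) \<le> len (list_product G (w # ws))"
proof -
  \<comment> \<open>The first length is counted in full: its spare half is what the induction step spends when a
    further step is put in front.\<close>
  have "len w + sum_list (map len ws) / 2 - (2 * c + 2 * \<delta>) \<le> len (list_product G (w # ws))"
    using assms
  proof (induction ws arbitrary: w)
    case Nil
    then show ?case using delta_nonneg by simp
  next
    case (Cons v vs)
    have gpw: "gp (inv w) (list_product G (v # vs)) \<le> c + \<delta>"
      using Cons.prems delta_nonneg by (intro chain_gp) (auto, smt (verit))
    have eq: "len (list_product G (w # v # vs))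
        = len w + len (list_product G (v # vs)) - 2 * gp (inv w) (list_product G (v # vs))"
      using Cons.prems len_mult_eq[of w "list_product G (v # vs)"] by simp
    show ?case
    proof (cases "vs = []")
      case True
      then show ?thesis using eq gpw Cons.prems len_nonneg[of v] by simp
    next
      case False
      have "len v + sum_list (map len vs) / 2 - (2 * c + 2 * \<delta>) \<le> len (list_product G (v # vs))"
        using Cons.prems False by (intro Cons.IH) auto
      moreover have "4 * c + 4 * \<delta> < len v" using Cons.prems False by auto
      ultimately show ?thesis using eq gpw by (simp add: field_simps)
    qed
  qed
  then show ?thesis using len_nonneg[of w] assms(1) by (simp add: field_simps)
qed

section \<open>Powers of an element that moves away\<close>

text \<open>Written as \<open>2 (u\<inverse> | u) + 3 \<delta> < |u|\<close>, the condition says that two consecutive steps \<open>u\<close> cancel less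
  than half of a step, with enough room for the errors in the estimates below.\<close>

definition axial :: "'a \<Rightarrow> bool"
  where "axial u \<longleftrightarrow> u \<in> carrier G \<and> len u + 3 * \<delta> < len (u \<otimes> u)"

lemma axial_closed [simp]: "axial u \<Longrightarrow> u \<in> carrier G"
  by (simp add: axial_def)

lemma axial_inv:
  assumes "axial u" shows "axial (inv u)"
proof -
  have "inv u \<otimes> inv u = inv (u \<otimes> u)" using assms by (simp add: inv_mult_group)
  then show ?thesis using assms by (simp add: axial_def)
qed

text \<open>The argument of \<open>chain_gp\<close> with all steps equal to \<open>u\<close>. Each further step \<open>u\<close> adds at least
  \<open>|u| - 2 (u\<inverse> | u) - 2 \<delta>\<close> to the length, which is positive.\<close>

lemma axial_gp_forward:
  assumes "axial u" shows "gp (inv u) (u [^] (j::nat)) \<le> gp (inv u) u + \<delta>"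
proof (induction j)
  case 0
  then show ?case using assms gp_nonneg[of "inv u" u] delta_nonneg by simp
next
  case (Suc j)
  have u: "u \<in> carrier G" using assms by simp
  have "2 * gp (inv u) u + 3 * \<delta> < len u"
    using assms len_mult_eq[OF u u] by (simp add: axial_def)
  moreover have "gp (u \<otimes> u [^] j) u = len u - gp (inv u) (u [^] j)"
    using u by (simp add: gp_mult_left)
  ultimately have "gp (inv u) u + \<delta> < gp u (u [^] Suc j)"
    using Suc u delta_nonneg nat_pow_Suc2[OF u, of j] gp_commute[of "u [^] Suc j" u] by simp
  then show ?case using u by (intro gp_separate[where z = u]) auto
qed

lemma axial_pow_len:
  assumes "axial u"
  shows "real j * (len (u \<otimes> u) - len u - 2 * \<delta>) \<le> len (u [^] j)"
proof (induction j)
  case 0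
  then show ?case by simp
next
  case (Suc j)
  have u: "u \<in> carrier G" using assms by simp
  have "len (u [^] Suc j) = len u + len (u [^] j) - 2 * gp (inv u) (u [^] j)"
    using u len_mult_eq[of u "u [^] j"] nat_pow_Suc2[OF u, of j] by simp
  then have "len (u [^] j) + (len (u \<otimes> u) - len u - 2 * \<delta>) \<le> len (u [^] Suc j)"
    using axial_gp_forward[OF assms, of j] len_mult_eq[OF u u] by linarith
  moreover have "real (Suc j) * \<kappa> = real j * \<kappa> + \<kappa>" for \<kappa> by (simp add: algebra_simps)
  ultimately show ?case using Suc by simp
qed

text \<open>Negative powers stay close to \<open>u\<inverse>\<close>, by \<open>axial_gp_forward\<close> for \<open>u\<inverse>\<close>, so they separate from the
  positive powers about where \<open>u\<inverse>\<close> does.\<close>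

lemma axial_gp_two_sided:
  assumes "axial u"
  shows "gp (inv (u [^] (j::nat))) (u [^] (i::nat)) \<le> gp (inv u) u + 2 * \<delta>"
proof (cases j)
  case 0
  then show ?thesis
    using assms gp_nonneg[of "inv u" u] gp_commute[of \<one> "u [^] i"] delta_nonneg by simp
next
  case (Suc k)
  have u: "u \<in> carrier G" using assms by simp
  let ?y = "inv u \<otimes> (inv u) [^] k"
  have y: "inv (u [^] j) = ?y"
    using u Suc nat_pow_inv[OF u, of j] nat_pow_Suc2[of "inv u" k] by simp
  have "gp (inv (inv u)) ((inv u) [^] k) \<le> gp (inv u) u + \<delta>"
    using axial_gp_forward[OF axial_inv[OF assms], of k] u gp_commute[of u "inv u"] by simp
  moreover have "gp ?y (inv u) = len u - gp (inv (inv u)) ((inv u) [^] k)"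
    using u by (simp add: gp_mult_left)
  moreover have "2 * gp (inv u) u + 3 * \<delta> < len u"
    using assms len_mult_eq[OF u u] by (simp add: axial_def)
  ultimately have "(gp (inv u) u + \<delta>) + \<delta> < gp (inv u) ?y"
    using u gp_commute[of "inv u" ?y] by simp
  then have "gp (u [^] i) ?y \<le> (gp (inv u) u + \<delta>) + \<delta>"
    using u axial_gp_forward[OF assms, of i] gp_commute[of "u [^] i" "inv u"]
    by (intro gp_separate[where z = "inv u" and c = "gp (inv u) u + \<delta>"]) auto
  then show ?thesis using u y gp_commute[of "u [^] i" ?y] by simp
qed

text \<open>Seen from \<open>u\<^sup>m\<close>, a later power and the identity lie in nearly opposite directions; hence \<open>u\<^sup>n\<close>
  passes close to \<open>u\<^sup>m\<close>, and the Gromov product is nearly the length of \<open>u\<^sup>m\<close>.\<close>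

lemma axial_gp_large:
  assumes "axial u"
  shows "\<exists>N. \<forall>m\<ge>N. \<forall>n\<ge>N. K \<le> gp (u [^] (m::nat)) (u [^] (n::nat))"
proof -
  have u: "u \<in> carrier G" using assms by simp
  define \<kappa> where "\<kappa> = len (u \<otimes> u) - len u - 2 * \<delta>"
  define B where "B = gp (inv u) u + 2 * \<delta>"
  have "0 < \<kappa>" using assms delta_nonneg by (auto simp: axial_def \<kappa>_def)
  then obtain N :: nat where N: "K + B \<le> real N * \<kappa>"
    using ex_less_of_nat_mult[of \<kappa> "K + B"] by (auto intro: less_imp_le)
  have ordered: "K \<le> gp (u [^] n) (u [^] m)" if "N \<le> m" "m \<le> n" for m n :: nat
  proof -
    have "u [^] n = u [^] m \<otimes> u [^] (n - m)" using u that by (simp add: nat_pow_mult)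
    then have "gp (u [^] n) (u [^] m) = len (u [^] m) - gp (inv (u [^] m)) (u [^] (n - m))"
      using u by (simp add: gp_mult_left)
    moreover have "real N * \<kappa> \<le> real m * \<kappa>" using that \<open>0 < \<kappa>\<close> by simp
    ultimately show ?thesis
      using N axial_pow_len[OF assms, of m] axial_gp_two_sided[OF assms, of m "n - m"]
      by (simp add: \<kappa>_def[symmetric] B_def)
  qed
  have "K \<le> gp (u [^] m) (u [^] n)" if "N \<le> m" "N \<le> n" for m n :: nat
    using ordered[of n m] ordered[of m n] that u gp_commute[of "u [^] m" "u [^] n"]
    by (cases "m \<le> n") auto
  then show ?thesis by blast
qed

text \<open>If no power were axial, every squaring would add at most \<open>3 \<delta>\<close> to the length, so the length
  of \<open>g\<close> to the power \<open>2\<^sup>i\<close> would grow at most linearly in \<open>i\<close>.\<close>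

lemma axial_power_of_linear_growth:
  assumes g: "g \<in> carrier G" and "0 < C"
    and growth: "\<And>n::nat. inverse C * real n - D \<le> len (g [^] n)"
  shows "\<exists>k::nat. axial (g [^] k)"
proof (rule ccontr)
  assume *: "\<nexists>k::nat. axial (g [^] k)"
  have upper: "len (g [^] ((2::nat) ^ i)) \<le> len g + 3 * \<delta> * real i" for i
  proof (induction i)
    case 0
    then show ?case using g by simp
  next
    case (Suc i)
    have "g [^] ((2::nat) ^ Suc i) = g [^] ((2::nat) ^ i) \<otimes> g [^] ((2::nat) ^ i)"
      using g by (simp add: nat_pow_mult mult_2)
    then have "len (g [^] ((2::nat) ^ Suc i)) \<le> len (g [^] ((2::nat) ^ i)) + 3 * \<delta>"
      using * g by (auto simp: axial_def not_less)
    then show ?case using Suc by (simp add: algebra_simps)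
  qed
  have "filterlim (\<lambda>i::nat. inverse C * 2 ^ i - D - (len g + 3 * \<delta> * real i)) at_top sequentially"
    using \<open>0 < C\<close> by real_asymp
  then obtain i :: nat where "0 < inverse C * 2 ^ i - D - (len g + 3 * \<delta> * real i)"
    unfolding filterlim_at_top_dense by (meson eventually_sequentially order_refl)
  then show False using upper[of i] growth[of "2 ^ i"] by simp
qed

text \<open>Two sequences of powers that do not converge to the same boundary point have a bounded product
  along some subsequence of indices; since high powers of each element are close to one another
  as seen from the identity, the bound carries over to all high powers. Low powers are bounded by
  their lengths.\<close>

lemma axial_gp_bounded:
  assumes "axial u" "axial v"
    and "\<not> filterlim (\<lambda>n::nat. gp (u [^] n) (v [^] n)) at_top sequentially"
  shows "\<exists>c. \<forall>m n. gp (u [^] (m::nat)) (v [^] (n::nat)) \<le> c"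
proof -
  have u: "u \<in> carrier G" and v: "v \<in> carrier G" using assms by auto
  obtain Z where Z: "\<And>N::nat. \<exists>n\<ge>N. gp (u [^] n) (v [^] n) < Z"
    using assms(3) unfolding filterlim_at_top eventually_sequentially by (meson not_le)
  obtain N1 where N1: "\<forall>m\<ge>N1. \<forall>n\<ge>N1. Z + 2 * \<delta> \<le> gp (u [^] (m::nat)) (u [^] (n::nat))"
    using axial_gp_large[OF assms(1)] by blast
  obtain N2 where N2: "\<forall>m\<ge>N2. \<forall>n\<ge>N2. Z + 2 * \<delta> \<le> gp (v [^] (m::nat)) (v [^] (n::nat))"
    using axial_gp_large[OF assms(2)] by blast
  obtain k where k: "N1 \<le> k" "N2 \<le> k" "gp (u [^] k) (v [^] k) < Z"
    using Z[of "max N1 N2"] by auto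
  have far: "gp (u [^] m) (v [^] n) \<le> Z + 2 * \<delta>" if "N1 \<le> m" "N2 \<le> n" for m n :: nat
  proof (rule ccontr)
    assume "\<not> ?thesis"
    moreover have "min (gp (u [^] k) (u [^] m)) (gp (u [^] m) (v [^] n)) - \<delta> \<le> gp (u [^] k) (v [^] n)"
      using u v by (intro gp_hyp) auto
    moreover have "min (gp (u [^] k) (v [^] n)) (gp (v [^] n) (v [^] k)) - \<delta> \<le> gp (u [^] k) (v [^] k)"
      using u v by (intro gp_hyp) auto
    ultimately show False using N1 N2 k that delta_nonneg
      by (smt (verit, best))
  qed
  have pow: "len (x [^] m) \<le> real m * len x" if "x \<in> carrier G" for x and m :: nat
  proof (induction m)
    case (Suc m)
    then show ?case using len_mult[of "x [^] m" x] that by (simp add: algebra_simps)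
  qed simp
  have near: "len (x [^] m) \<le> real N * len x" if "x \<in> carrier G" "m < N" for x and m N :: nat
    using pow[OF that(1), of m] mult_right_mono[of "real m" "real N" "len x"] len_nonneg that
    by force
  have "gp (u [^] m) (v [^] n) \<le> max (Z + 2 * \<delta>) (max (real N1 * len u) (real N2 * len v))"
    for m n :: nat
    using far[of m n] near[of u m N1] near[of v n N2] u v
      gp_le_len[of "u [^] m" "v [^] n"] gp_le_len[of "v [^] n" "u [^] m"]
      gp_commute[of "u [^] m" "v [^] n"]
    by (cases "m < N1"; cases "n < N2") auto
  then show ?thesis by blast
qed

section \<open>Elements with prescribed initial and final directions\<close>

definition gate :: "'a \<Rightarrow> 'a \<Rightarrow> real \<Rightarrow> 'a set"
  where "gate a b K = {x \<in> carrier G. K \<le> gp x a \<and> K \<le> gp (inv x) b}"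

lemma gate_len:
  assumes "a \<in> carrier G" "x \<in> gate a b K" shows "K \<le> len x"
  using assms gp_le_len[of x a] by (auto simp: gate_def)

lemma gate_junction:
  assumes "a \<in> carrier G" "b \<in> carrier G" and "gp a b \<le> c" "c + 2 * \<delta> < K"
    and "x \<in> gate a b K" "y \<in> gate a b K"
  shows "gp (inv x) y \<le> c + 2 * \<delta>"
proof -
  have x: "inv x \<in> carrier G" "K \<le> gp b (inv x)" and y: "y \<in> carrier G" "K \<le> gp a y"
    using assms gp_commute[of "inv x" b] gp_commute[of y a] by (auto simp: gate_def)
  have "gp a (inv x) \<le> c + \<delta>"
    using assms x delta_nonneg by (intro gp_separate[where z = b]) auto
  then have "gp (inv x) y \<le> (c + \<delta>) + \<delta>"
    using assms x y gp_commute[of a "inv x"]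
    by (intro gp_separate[where z = a and c = "c + \<delta>"]) auto
  then show ?thesis by simp
qed

text \<open>Both ends are decided by transitivity. Little of \<open>r\<close> is cancelled in \<open>x r\<close>, and little of \<open>l\<close> in
  \<open>l x r\<close>, so \<open>l x r\<close> starts like \<open>l\<close>. Its end is compared with that of \<open>r\<close> through \<open>x r\<close>, which costs
  \<open>2 \<delta>\<close> and one more cancellation \<open>c\<close>.\<close>

lemma gate_sandwich:
  assumes [simp]: "a \<in> carrier G" "b \<in> carrier G" "l \<in> carrier G" "x \<in> carrier G" "r \<in> carrier G"
    and right: "gp r (inv x) \<le> c" and left: "gp (inv l) (x \<otimes> r) \<le> c"
    and "K + \<delta> \<le> gp l a" "K + 2 * \<delta> \<le> gp (inv r) b"
    and "K + \<delta> + c \<le> len l" "K + 2 * \<delta> + 2 * c \<le> len r"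
  shows "l \<otimes> x \<otimes> r \<in> gate a b K"
proof -
  let ?y = "x \<otimes> r"
  have assoc: "l \<otimes> x \<otimes> r = l \<otimes> ?y" by (simp add: m_assoc)
  have "gp (l \<otimes> ?y) l = len l - gp (inv l) ?y" by (simp add: gp_mult_left)
  moreover have "min (gp (l \<otimes> ?y) l) (gp l a) - \<delta> \<le> gp (l \<otimes> ?y) a" by (rule gp_hyp) auto
  ultimately have start: "K \<le> gp (l \<otimes> ?y) a" using assms by linarith
  have inv_y: "inv ?y = inv r \<otimes> inv x" by (simp add: inv_mult_group)
  have "gp (inv ?y) (inv r) = len r - gp r (inv x)"
    unfolding inv_y by (subst gp_mult_left) auto
  moreover have "min (gp (inv ?y) (inv r)) (gp (inv r) b) - \<delta> \<le> gp (inv ?y) b" by (rule gp_hyp) auto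
  ultimately have mid: "K + \<delta> \<le> gp (inv ?y) b" "len r - c \<le> gp (inv ?y) (inv r)"
    using assms delta_nonneg gp_nonneg[of "r" "inv x"] by (auto simp: min_def split: if_splits)
  have len_y: "len r - c \<le> len ?y"
    using mid(2) gp_le_len[of "inv ?y" "inv r"] by simp
  have inv_ly: "inv (l \<otimes> ?y) = inv ?y \<otimes> inv l" by (simp add: inv_mult_group)
  have "gp (inv (l \<otimes> ?y)) (inv ?y) = len ?y - gp ?y (inv l)"
    unfolding inv_ly by (subst gp_mult_left) auto
  moreover have "gp ?y (inv l) \<le> c" using left gp_commute[of ?y "inv l"] by simp
  moreover have "min (gp (inv (l \<otimes> ?y)) (inv ?y)) (gp (inv ?y) b) - \<delta> \<le> gp (inv (l \<otimes> ?y)) b"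
    by (rule gp_hyp) auto
  ultimately have "K \<le> gp (inv (l \<otimes> ?y)) b" using assms len_y mid delta_nonneg by linarith
  then show ?thesis using start by (simp add: gate_def assoc)
qed

text \<open>In a word that alternates between powers of \<open>u\<close> and of \<open>v\<close>, every junction has one of these four
  sign patterns, possibly with \<open>u\<close> and \<open>v\<close> exchanged.\<close>

definition transverse :: "real \<Rightarrow> 'a \<Rightarrow> 'a \<Rightarrow> bool"
  where "transverse c u v \<longleftrightarrow> u \<in> carrier G \<and> v \<in> carrier G \<and>
    (\<forall>(m::nat) (n::nat). \<forall>x\<in>{u [^] m, inv (u [^] m)}. \<forall>y\<in>{v [^] n, inv (v [^] n)}. gp x y \<le> c)"

lemma transverseD:
  assumes "transverse c u v"
  shows "u \<in> carrier G" "v \<in> carrier G"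
    "gp (u [^] (m::nat)) (v [^] (n::nat)) \<le> c" "gp (inv (u [^] m)) (v [^] n) \<le> c"
    "gp (u [^] m) (inv (v [^] n)) \<le> c" "gp (inv (u [^] m)) (inv (v [^] n)) \<le> c"
  using assms unfolding transverse_def by blast+

lemma transverse_sym:
  assumes "transverse c u v" shows "transverse c v u"
proof -
  have "gp y x \<le> c"
    if "x \<in> {u [^] m, inv (u [^] m)}" "y \<in> {v [^] n, inv (v [^] n)}" for x y and m n :: nat
  proof -
    have "gp x y \<le> c" using assms that unfolding transverse_def by blast
    moreover have "x \<in> carrier G" "y \<in> carrier G" using transverseD(1,2)[OF assms] that by auto
    ultimately show ?thesis using gp_commute[of x y] by simp
  qed
  then show ?thesis using assms unfolding transverse_def by blast
qed

text \<open>The word \<open>u\<^sup>p v\<^sup>-\<^sup>q\<close> has only one junction, at which transversality bounds the cancellation.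
  Its inverse is a word of the same shape with the two elements exchanged, so the lemma also
  controls the other end.\<close>

lemma turn_gp:
  assumes "transverse c u v" and "K \<le> gp (u [^] (p::nat)) (u [^] (N::nat))"
  shows "K - c - \<delta> \<le> gp (u [^] p \<otimes> inv (v [^] (q::nat))) (u [^] N)"
proof -
  have uv: "u \<in> carrier G" "v \<in> carrier G" and "gp (inv (u [^] p)) (inv (v [^] q)) \<le> c"
    using transverseD[OF assms(1)] by blast+
  then have "len (u [^] p) - c \<le> gp (u [^] p \<otimes> inv (v [^] q)) (u [^] p)"
    by (simp add: gp_mult_left)
  moreover have "min (gp (u [^] p \<otimes> inv (v [^] q)) (u [^] p)) (gp (u [^] p) (u [^] N)) - \<delta>
      \<le> gp (u [^] p \<otimes> inv (v [^] q)) (u [^] N)"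
    using uv by (intro gp_hyp) auto
  moreover have "K \<le> len (u [^] p)"
    using assms(2) gp_le_len[of "u [^] p" "u [^] N"] uv by simp
  moreover have "0 \<le> c"
    using transverseD(3)[OF assms(1), of 0 0] gp_nonneg[of \<one> \<one>] by simp
  ultimately show ?thesis using assms(2) by linarith
qed

lemma turn_len:
  assumes "transverse c u v"
  shows "len (v [^] q) - 2 * c \<le> len (u [^] (p::nat) \<otimes> inv (v [^] (q::nat)))"
  using transverseD(1,2)[OF assms] transverseD(6)[OF assms, of p q]
    len_mult_eq[of "u [^] p" "inv (v [^] q)"] len_nonneg[of "u [^] p"] by simp

text \<open>The two words agree along \<open>u\<^sup>N\<close>. There one of them turns into a power of \<open>v\<close> while the other
  goes on along \<open>u\<close>, and these directions are transverse. Hence no \<open>x\<close> can follow both words much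
  beyond \<open>u\<^sup>N\<close>, however large \<open>M\<close> is.\<close>

lemma turns_diverge:
  assumes uv: "transverse c u v" and long: "2 * c + \<delta> < len (u [^] (N::nat))" and x: "x \<in> carrier G"
  shows "gp (u [^] N \<otimes> inv (v [^] (M::nat))) x \<le> len (u [^] N) + c + 2 * \<delta> \<or>
    gp (u [^] (2 * N) \<otimes> inv (v [^] M)) x \<le> len (u [^] N) + c + 2 * \<delta>"
proof -
  have [simp]: "u \<in> carrier G" "v \<in> carrier G" using transverseD[OF uv] by auto
  let ?w = "u [^] N \<otimes> inv (v [^] M)"
  have w: "u [^] (2 * N) \<otimes> inv (v [^] M) = u [^] N \<otimes> ?w"
    by (simp add: m_assoc[symmetric] nat_pow_mult mult_2)
  have c: "gp (inv (u [^] N)) (inv (v [^] M)) \<le> c" "gp (inv (v [^] M)) (u [^] N) \<le> c"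
    using transverseD[OF uv] transverseD[OF transverse_sym[OF uv]] by blast+
  have "c + \<delta> < gp (u [^] N) ?w"
    using c long by (subst gp_commute) (auto simp: gp_mult_left)
  then have "gp (inv (v [^] M)) ?w \<le> c + \<delta>"
    using c by (intro gp_separate[where z = "u [^] N"]) auto
  then have "gp ?w (u [^] N \<otimes> ?w) \<le> len (u [^] N) + (c + \<delta>)"
    using gp_translate[of "u [^] N" "inv (v [^] M)" ?w] by simp
  moreover have "min (gp ?w x) (gp x (u [^] N \<otimes> ?w)) - \<delta> \<le> gp ?w (u [^] N \<otimes> ?w)"
    using x by (intro gp_hyp) auto
  moreover have "gp x (u [^] N \<otimes> ?w) = gp (u [^] N \<otimes> ?w) x"
    using x by (intro gp_commute) auto
  ultimately show ?thesis unfolding w by linarith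
qed

text \<open>The exponent \<open>N\<close> is chosen so that \<open>N\<close>-th powers determine a direction up to \<open>K\<close> and some
  slack. Divergence at \<open>u\<^sup>N\<close> or \<open>v\<^sup>N\<close> then bounds, for one of two words, the cancellation with a given
  element by a constant \<open>c1\<close> that depends only on \<open>N\<close>, and only afterwards is \<open>M\<close> chosen so large that the words are
  long compared with \<open>c1\<close>. The words \<open>u\<^sup>N v\<^sup>-\<^sup>M\<close> and \<open>u\<^sup>2\<^sup>N v\<^sup>-\<^sup>M\<close> serve on the right, and
  \<open>u\<^sup>M v\<^sup>-\<^sup>N\<close> and \<open>u\<^sup>M v\<^sup>-\<^sup>2\<^sup>N\<close> on the left, where their inverses diverge.\<close>

lemma gate_absorbs:
  assumes u: "axial u" and v: "axial v" and uv: "transverse c u v" and "0 \<le> c" "c < K"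
  shows "\<exists>a\<in>carrier G. \<exists>b\<in>carrier G. \<exists>F. gp a b \<le> c \<and> finite F \<and> F \<subseteq> gate a b K \<and>
    (\<forall>x\<in>carrier G. \<exists>l\<in>F. \<exists>r\<in>F. l \<otimes> x \<otimes> r \<in> gate a b K)"
proof -
  have [simp]: "u \<in> carrier G" "v \<in> carrier G" using u v by auto
  define K1 where "K1 = K + c + 3 * \<delta>"
  obtain N1 N2 where "\<forall>m\<ge>N1. \<forall>n\<ge>N1. K1 \<le> gp (u [^] (m::nat)) (u [^] (n::nat))"
      "\<forall>m\<ge>N2. \<forall>n\<ge>N2. K1 \<le> gp (v [^] (m::nat)) (v [^] (n::nat))"
    using axial_gp_large[OF u] axial_gp_large[OF v] by blast
  then obtain N where N: "\<And>m n::nat. N \<le> m \<Longrightarrow> N \<le> n \<Longrightarrow> K1 \<le> gp (u [^] m) (u [^] n)"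
      "\<And>m n::nat. N \<le> m \<Longrightarrow> N \<le> n \<Longrightarrow> K1 \<le> gp (v [^] m) (v [^] n)"
    by (intro that[of "max N1 N2"]) auto
  define c1 where "c1 = max (len (u [^] N)) (len (v [^] N)) + c + 2 * \<delta>"
  define K2 where "K2 = K + 2 * \<delta> + 2 * c1 + 2 * c"
  obtain M1 M2 where far: "\<forall>m\<ge>M1. \<forall>n\<ge>M1. K2 \<le> gp (u [^] (m::nat)) (u [^] (n::nat))"
      "\<forall>m\<ge>M2. \<forall>n\<ge>M2. K2 \<le> gp (v [^] (m::nat)) (v [^] (n::nat))"
    using axial_gp_large[OF u] axial_gp_large[OF v] by blast
  define M where "M = max N (max M1 M2)"
  have "N \<le> M" "M1 \<le> M" "M2 \<le> M" by (auto simp: M_def)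
  then have "K2 \<le> gp (u [^] M) (u [^] M)" "K2 \<le> gp (v [^] M) (v [^] M)" using far by blast+
  then have M: "N \<le> M" "K2 \<le> len (u [^] M)" "K2 \<le> len (v [^] M)" using \<open>N \<le> M\<close> by simp_all
  define a where "a = u [^] N"
  define b where "b = v [^] N"
  define turn where "turn p q = u [^] p \<otimes> inv (v [^] q)" for p q :: nat
  have turn [simp]: "turn p q \<in> carrier G" "inv (turn p q) = v [^] q \<otimes> inv (u [^] p)" for p q
    by (auto simp: turn_def inv_mult_group)
  have ends: "K + 2 * \<delta> \<le> gp (turn p q) a" "K + 2 * \<delta> \<le> gp (inv (turn p q)) b"
    if "N \<le> p" "N \<le> q" for p q
    using turn_gp[OF uv, of K1 p N q] turn_gp[OF transverse_sym[OF uv], of K1 q N p] N that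
    unfolding a_def b_def turn(2) by (auto simp: K1_def turn_def)
  have in_gate: "turn p q \<in> gate a b K" if "N \<le> p" "N \<le> q" for p q
    using ends[OF that] delta_nonneg by (auto simp: gate_def simp del: turn(2))
  have long: "K2 - 2 * c \<le> len (turn p M)" "K2 - 2 * c \<le> len (turn M p)" for p
    using M turn_len[OF uv, of M p] turn_len[OF transverse_sym[OF uv], of M p]
      len_inv[OF turn(1), of M p] unfolding turn(2) by (auto simp: turn_def)
  have len_N: "2 * c + \<delta> < len (u [^] N)" "2 * c + \<delta> < len (v [^] N)"
    using N[of N N] \<open>c < K\<close> delta_nonneg by (auto simp: K1_def)
  have right: "\<exists>i\<in>{N, 2 * N}. gp (turn i M) x \<le> c1"
    and left: "\<exists>i\<in>{N, 2 * N}. gp (inv (turn M i)) x \<le> c1" if "x \<in> carrier G" for x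
    using turns_diverge[OF uv len_N(1) that, of M]
      turns_diverge[OF transverse_sym[OF uv] len_N(2) that, of M]
    unfolding turn(2) by (auto simp: turn_def c1_def)
  have "\<exists>l\<in>{turn M N, turn M (2 * N)}. \<exists>r\<in>{turn N M, turn (2 * N) M}. l \<otimes> x \<otimes> r \<in> gate a b K"
    if x: "x \<in> carrier G" for x
  proof -
    \<comment> \<open>The right factor is chosen first and the left one afterwards, for the product of \<open>x\<close> with it.\<close>
    obtain i where i: "i \<in> {N, 2 * N}" "gp (turn i M) (inv x) \<le> c1"
      using right[of "inv x"] x by auto
    obtain j where j: "j \<in> {N, 2 * N}" "gp (inv (turn M j)) (x \<otimes> turn i M) \<le> c1"
      using left[of "x \<otimes> turn i M"] x by auto
    have "0 \<le> c1" using \<open>0 \<le> c\<close> delta_nonneg len_nonneg[of "u [^] N"] by (simp add: c1_def)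
    have "turn M j \<otimes> x \<otimes> turn i M \<in> gate a b K"
      using i j x ends[of M j] ends[of i M] M long[of i] long[of j] \<open>0 \<le> c1\<close> delta_nonneg
      by (intro gate_sandwich[where c = c1]) (auto simp: a_def b_def K2_def simp del: turn(2))
    then show ?thesis using i j by blast
  qed
  moreover have "{turn M N, turn M (2 * N), turn N M, turn (2 * N) M} \<subseteq> gate a b K"
    using in_gate M by auto
  moreover have "gp a b \<le> c" using transverseD(3)[OF uv] by (simp add: a_def b_def)
  ultimately show ?thesis
    by (intro bexI[of _ a] bexI[of _ b] exI[of _ "{turn M N, turn M (2 * N), turn N M, turn (2 * N) M}"])
      (auto simp: a_def b_def)
qed

end

lemma (in group) inv_commute:
  assumes "g \<in> carrier G" "u \<in> carrier G" "g \<otimes> u = u \<otimes> g"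
  shows "inv g \<otimes> u = u \<otimes> inv g"
proof -
  have "inv g \<otimes> u = inv g \<otimes> (u \<otimes> g) \<otimes> inv g" using assms(1,2) by (simp add: m_assoc)
  also have "\<dots> = inv g \<otimes> (g \<otimes> u) \<otimes> inv g" using assms by simp
  also have "\<dots> = u \<otimes> inv g" using assms(1,2) by (simp add: m_assoc[symmetric])
  finally show ?thesis .
qed

section \<open>Word length\<close>

locale word_metric = group G for G (structure) +
  fixes S :: "'a set"
  assumes generating: "finite_symmetric_generating_set G S"
begin

abbreviation wlen :: "'a \<Rightarrow> nat" where "wlen \<equiv> word_length G S"

lemma generators_closed: "set ws \<subseteq> S \<Longrightarrow> set ws \<subseteq> carrier G"
  using generating by (auto simp: finite_symmetric_generating_set_def)

lemma exists_word:
  assumes "x \<in> carrier G" shows "\<exists>ws. set ws \<subseteq> S \<and> list_product G ws = x"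
proof -
  have "x \<in> generate G S" using assms generating by (simp add: finite_symmetric_generating_set_def)
  then show ?thesis
  proof induction
    case one
    then show ?case by (intro exI[of _ "[]"]) simp
  next
    case (incl h)
    then show ?case using generators_closed[of "[h]"] by (intro exI[of _ "[h]"]) simp
  next
    case (inv h)
    then have "inv h \<in> S" using generating by (auto simp: finite_symmetric_generating_set_def)
    then show ?case using generators_closed[of "[inv h]"] by (intro exI[of _ "[inv h]"]) simp
  next
    case (eng h1 h2)
    then obtain ws1 ws2 where "set ws1 \<subseteq> S" "list_product G ws1 = h1"
        "set ws2 \<subseteq> S" "list_product G ws2 = h2" by blast
    then show ?case
      using generators_closed by (intro exI[of _ "ws1 @ ws2"]) (simp add: list_product_append)
  qed
qed

lemma exists_shortest_word:
  assumes "x \<in> carrier G"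
  shows "\<exists>ws. set ws \<subseteq> S \<and> length ws = wlen x \<and> list_product G ws = x"
proof -
  have "\<exists>n ws. set ws \<subseteq> S \<and> length ws = n \<and> list_product G ws = x"
    using exists_word[OF assms] by blast
  then show ?thesis unfolding word_length_def by (rule LeastI_ex)
qed

lemma wlen_le_length: "set ws \<subseteq> S \<Longrightarrow> wlen (list_product G ws) \<le> length ws"
  unfolding word_length_def by (rule Least_le) blast

lemma wlen_mult:
  assumes "x \<in> carrier G" "y \<in> carrier G" shows "wlen (x \<otimes> y) \<le> wlen x + wlen y"
proof -
  obtain ws vs where ws: "set ws \<subseteq> S" "length ws = wlen x" "list_product G ws = x"
    and vs: "set vs \<subseteq> S" "length vs = wlen y" "list_product G vs = y"
    using exists_shortest_word assms by meson
  then show ?thesis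
    using wlen_le_length[of "ws @ vs"] generators_closed by (simp add: list_product_append)
qed

lemma wlen_one: "wlen \<one> = 0"
  using wlen_le_length[of "[]"] by simp

lemma list_product_rev_inv:
  "set ws \<subseteq> carrier G \<Longrightarrow> list_product G (rev (map (\<lambda>s. inv s) ws)) = inv (list_product G ws)"
proof (induction ws)
  case (Cons s ws)
  moreover have "set (rev (map (\<lambda>s. inv s) ws)) \<subseteq> carrier G" using Cons.prems by auto
  ultimately show ?case by (simp add: list_product_append inv_mult_group del: rev_map)
qed simp

lemma wlen_inv:
  assumes "x \<in> carrier G" shows "wlen (inv x) = wlen x"
proof -
  have le: "wlen (inv y) \<le> wlen y" if y: "y \<in> carrier G" for y
  proof -
    obtain ws where ws: "set ws \<subseteq> S" "length ws = wlen y" "list_product G ws = y"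
      using exists_shortest_word[OF y] by blast
    moreover have "set (rev (map (\<lambda>s. inv s) ws)) \<subseteq> S"
      using ws generating by (auto simp: finite_symmetric_generating_set_def)
    ultimately show ?thesis
      using wlen_le_length[of "rev (map (\<lambda>s. inv s) ws)"] generators_closed
      by (simp add: list_product_rev_inv)
  qed
  show ?thesis using le[of x] le[of "inv x"] assms by simp
qed

definition geodesic_word :: "'a list \<Rightarrow> bool"
  where "geodesic_word ws \<longleftrightarrow> set ws \<subseteq> S \<and> wlen (list_product G ws) = length ws"

lemma geodesic_word_closed: "geodesic_word ws \<Longrightarrow> list_product G ws \<in> carrier G"
  by (simp add: geodesic_word_def generators_closed)

lemma geodesic_word_append:
  assumes "geodesic_word (p @ q)" shows "geodesic_word p" "geodesic_word q"
proof -
  have "set p \<subseteq> S" "set q \<subseteq> S" using assms by (auto simp: geodesic_word_def)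
  moreover from this have "wlen (list_product G (p @ q)) \<le> wlen (list_product G p) + wlen (list_product G q)"
    using generators_closed by (simp add: list_product_append wlen_mult)
  ultimately show "geodesic_word p" "geodesic_word q"
    using assms wlen_le_length[of p] wlen_le_length[of q] by (auto simp: geodesic_word_def)
qed

lemma word_dist_sym:
  assumes "x \<in> carrier G" "y \<in> carrier G"
  shows "word_dist G S x y = word_dist G S y x"
  using wlen_inv[of "inv x \<otimes> y"] assms by (simp add: word_dist_def inv_mult_group)

end

locale hyperbolic_group = word_metric G S + hyperbolic_length G "\<lambda>x. real (word_length G S x)" \<delta>
  for G (structure) and S \<delta>
begin

lemma gromov_product_eq_gp:
  "x \<in> carrier G \<Longrightarrow> y \<in> carrier G \<Longrightarrow> gromov_product G S \<one> x y = gp x y"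
  by (simp add: gromov_product_def gp_def word_dist_def wlen_inv)

end

lemma (in word_metric) hyperbolic_group_of_hyperbolic:
  assumes "hyperbolic G S" shows "\<exists>\<delta>. hyperbolic_group G S \<delta>"
proof -
  obtain \<delta> where "0 \<le> \<delta>" and \<delta>: "\<And>x y z. \<lbrakk>x \<in> carrier G; y \<in> carrier G; z \<in> carrier G\<rbrakk> \<Longrightarrow>
      min (gromov_product G S \<one> x y) (gromov_product G S \<one> y z) - \<delta> \<le> gromov_product G S \<one> x z"
    using assms unfolding hyperbolic_def by (metis one_closed)
  have "hyperbolic_group G S \<delta>"
  proof unfold_locales
    fix x y z assume [simp]: "x \<in> carrier G" "y \<in> carrier G" "z \<in> carrier G"
    show "real (wlen (x \<otimes> y)) \<le> real (wlen x) + real (wlen y)"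
      using wlen_mult[of x y] by simp
    show "min ((real (wlen x) + real (wlen y) - real (wlen (inv x \<otimes> y))) / 2)
        ((real (wlen y) + real (wlen z) - real (wlen (inv y \<otimes> z))) / 2) - \<delta>
      \<le> (real (wlen x) + real (wlen z) - real (wlen (inv x \<otimes> z))) / 2"
      using \<delta>[of x y z] by (simp add: gromov_product_def word_dist_def wlen_inv)
  qed (use \<open>0 \<le> \<delta>\<close> in \<open>auto simp: wlen_one wlen_inv\<close>)
  then show ?thesis by blast
qed

section \<open>Boundary points fixed by loxodromic elements\<close>

context hyperbolic_group
begin

lemma gromov_sequences_iff:
  "x \<in> gromov_sequences G S \<longleftrightarrow> range x \<subseteq> carrier G \<and>
    (\<forall>K. \<exists>N. \<forall>m\<ge>N. \<forall>n\<ge>N. K \<le> gp (x m) (x n))"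
proof (cases "range x \<subseteq> carrier G")
  case True
  then have "gromov_product G S \<one> (x m) (x n) = gp (x m) (x n)" for m n
    by (intro gromov_product_eq_gp) auto
  moreover have "(\<exists>N. \<forall>m\<ge>N. \<forall>n\<ge>N. K \<le> gp (x n) (x m)) \<longleftrightarrow> (\<exists>N. \<forall>m\<ge>N. \<forall>n\<ge>N. K \<le> gp (x m) (x n))" for K
    by (intro iff_exI) blast
  ultimately show ?thesis
    using True by (simp add: gromov_sequences_def filterlim_at_top eventually_prod_sequentially)
next
  case False
  then show ?thesis by (auto simp: gromov_sequences_def)
qed

lemma gromov_equivalence_iff:
  "(x, y) \<in> gromov_equivalence G S \<longleftrightarrow> x \<in> gromov_sequences G S \<and> y \<in> gromov_sequences G S \<and>
    filterlim (\<lambda>n. gp (x n) (y n)) at_top sequentially"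
proof -
  have "gromov_product G S \<one> (x n) (y n) = gp (x n) (y n)"
    if "x \<in> gromov_sequences G S" "y \<in> gromov_sequences G S" for n
    using that by (intro gromov_product_eq_gp) (auto simp: gromov_sequences_iff)
  then show ?thesis by (auto simp: gromov_equivalence_def)
qed

lemma gromov_sequences_closed: "x \<in> gromov_sequences G S \<Longrightarrow> x n \<in> carrier G"
  by (auto simp: gromov_sequences_iff)

lemma gromov_sequence_self:
  assumes "x \<in> gromov_sequences G S"
  shows "filterlim (\<lambda>n. gp (x n) (x n)) at_top sequentially"
  unfolding filterlim_at_top eventually_sequentially
proof
  fix K
  obtain N where "\<forall>m\<ge>N. \<forall>n\<ge>N. K \<le> gp (x m) (x n)"
    using assms unfolding gromov_sequences_iff by blast
  then have "\<forall>n\<ge>N. K \<le> gp (x n) (x n)" by blast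
  then show "\<exists>N. \<forall>n\<ge>N. K \<le> gp (x n) (x n)" ..
qed

lemma equiv_gromov: "equiv (gromov_sequences G S) (gromov_equivalence G S)"
proof (rule equivI)
  show "gromov_equivalence G S \<subseteq> gromov_sequences G S \<times> gromov_sequences G S"
    by (auto simp: gromov_equivalence_def)
  show "refl_on (gromov_sequences G S) (gromov_equivalence G S)"
    by (auto simp: refl_on_def gromov_equivalence_iff gromov_sequence_self)
  show "sym (gromov_equivalence G S)"
  proof (rule symI)
    fix x y assume xy: "(x, y) \<in> gromov_equivalence G S"
    then have "(\<lambda>n. gp (y n) (x n)) = (\<lambda>n. gp (x n) (y n))"
      by (intro ext gp_commute gromov_sequences_closed) (auto simp: gromov_equivalence_iff)
    then show "(y, x) \<in> gromov_equivalence G S" using xy by (simp add: gromov_equivalence_iff)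
  qed
  show "trans (gromov_equivalence G S)"
  proof (rule transI)
    fix x y z assume xy: "(x, y) \<in> gromov_equivalence G S" and yz: "(y, z) \<in> gromov_equivalence G S"
    have "filterlim (\<lambda>n. gp (x n) (z n)) at_top sequentially"
      unfolding filterlim_at_top
    proof
      fix Z
      have "\<forall>\<^sub>F n in sequentially. Z + \<delta> \<le> gp (x n) (y n)" "\<forall>\<^sub>F n in sequentially. Z + \<delta> \<le> gp (y n) (z n)"
        using xy yz unfolding gromov_equivalence_iff filterlim_at_top by blast+
      then show "\<forall>\<^sub>F n in sequentially. Z \<le> gp (x n) (z n)"
      proof eventually_elim
        case (elim n)
        have "min (gp (x n) (y n)) (gp (y n) (z n)) - \<delta> \<le> gp (x n) (z n)"
          using xy yz by (intro gp_hyp gromov_sequences_closed) (auto simp: gromov_equivalence_iff)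
        then show ?case using elim by linarith
      qed
    qed
    then show "(x, z) \<in> gromov_equivalence G S"
      using xy yz by (auto simp: gromov_equivalence_iff)
  qed
qed

lemma gp_translate_lower:
  assumes "g \<in> carrier G" "x \<in> carrier G" "y \<in> carrier G"
  shows "gp x y - wlen g \<le> gp (g \<otimes> x) (g \<otimes> y)"
proof -
  have "inv g \<otimes> (g \<otimes> x) = x" "inv g \<otimes> (g \<otimes> y) = y"
    using assms by (simp_all add: m_assoc[symmetric])
  then show ?thesis
    using gp_translate[of "inv g" "g \<otimes> x" "g \<otimes> y"] assms by (simp add: wlen_inv)
qed

lemma gromov_equivalence_translate:
  assumes g: "g \<in> carrier G" and xy: "(x, y) \<in> gromov_equivalence G S"
  shows "(\<lambda>n. g \<otimes> x n, \<lambda>n. g \<otimes> y n) \<in> gromov_equivalence G S"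
proof -
  have seq: "(\<lambda>n. g \<otimes> z n) \<in> gromov_sequences G S" if z: "z \<in> gromov_sequences G S" for z
    unfolding gromov_sequences_iff
  proof (intro conjI allI)
    show "range (\<lambda>n. g \<otimes> z n) \<subseteq> carrier G" using g gromov_sequences_closed[OF z] by auto
  next
    fix K :: real
    obtain N where N: "\<forall>m\<ge>N. \<forall>n\<ge>N. K + wlen g \<le> gp (z m) (z n)"
      using z unfolding gromov_sequences_iff by blast
    have "K \<le> gp (g \<otimes> z m) (g \<otimes> z n)" if "N \<le> m" "N \<le> n" for m n
    proof -
      have "K + wlen g \<le> gp (z m) (z n)" using N that by blast
      then show ?thesis
        using gp_translate_lower[OF g gromov_sequences_closed[OF z] gromov_sequences_closed[OF z], of m n]
        by linarith
    qed
    then show "\<exists>N. \<forall>m\<ge>N. \<forall>n\<ge>N. K \<le> gp (g \<otimes> z m) (g \<otimes> z n)" by blast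
  qed
  have x: "x \<in> gromov_sequences G S" and y: "y \<in> gromov_sequences G S"
    and lim: "filterlim (\<lambda>n. gp (x n) (y n)) at_top sequentially"
    using xy by (auto simp: gromov_equivalence_iff)
  have "filterlim (\<lambda>n. - real (wlen g) + gp (x n) (y n)) at_top sequentially"
    by (rule filterlim_tendsto_add_at_top[OF tendsto_const lim])
  then have "filterlim (\<lambda>n. gp (g \<otimes> x n) (g \<otimes> y n)) at_top sequentially"
  proof (rule filterlim_at_top_mono, intro always_eventually allI)
    fix n
    show "- real (wlen g) + gp (x n) (y n) \<le> gp (g \<otimes> x n) (g \<otimes> y n)"
      using gp_translate_lower[OF g gromov_sequences_closed[OF x] gromov_sequences_closed[OF y], of n n]
      by linarith
  qed
  then show ?thesis using seq x y by (simp add: gromov_equivalence_iff)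
qed

lemma axial_powers_gromov_sequence:
  "axial u \<Longrightarrow> (\<lambda>n. u [^] (n::nat)) \<in> gromov_sequences G S"
  unfolding gromov_sequences_iff by (intro conjI allI axial_gp_large) auto

text \<open>As \<open>g\<close> commutes with \<open>u\<close>, the translate \<open>g u\<^sup>n = u\<^sup>n g\<close> stays at distance \<open>|g|\<close> from
  \<open>u\<^sup>n\<close>.\<close>

lemma axial_powers_translate:
  assumes u: "axial u" and g: "g \<in> carrier G" "g \<otimes> u = u \<otimes> g"
  shows "(\<lambda>n. g \<otimes> u [^] (n::nat), \<lambda>n. u [^] n) \<in> gromov_equivalence G S"
proof -
  have [simp]: "u \<in> carrier G" using u by simp
  have refl: "(\<lambda>n. u [^] n, \<lambda>n. u [^] n) \<in> gromov_equivalence G S"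
    using axial_powers_gromov_sequence[OF u] by (simp only: gromov_equivalence_iff gromov_sequence_self)
  have "filterlim (\<lambda>n. - real (wlen g) + gp (u [^] n) (u [^] n)) at_top sequentially"
    by (intro filterlim_tendsto_add_at_top[OF tendsto_const] gromov_sequence_self
        axial_powers_gromov_sequence u)
  moreover have "- real (wlen g) + gp (u [^] n) (u [^] n) \<le> gp (g \<otimes> u [^] n) (u [^] n)" for n :: nat
  proof -
    have "g \<otimes> u [^] n = u [^] n \<otimes> g" using g by (metis group_commutes_pow \<open>u \<in> carrier G\<close>)
    then have "gp (g \<otimes> u [^] n) (u [^] n) = wlen (u [^] n) - gp (inv (u [^] n)) g"
      using g by (simp add: gp_mult_left)
    moreover have "gp (inv (u [^] n)) g \<le> wlen g"
      using g gp_le_len[of g "inv (u [^] n)"] gp_commute[of g "inv (u [^] n)"] by simp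
    ultimately show ?thesis by simp
  qed
  ultimately have "filterlim (\<lambda>n. gp (g \<otimes> u [^] n) (u [^] n)) at_top sequentially"
    by (rule filterlim_at_top_mono[OF _ always_eventually[OF allI]])
  then show ?thesis
    using gromov_equivalence_translate[OF g(1) refl] refl by (simp add: gromov_equivalence_iff)
qed

text \<open>For a power \<open>u\<close> of \<open>g\<close>, and for its inverse, this produces fixed points of \<open>g\<close> itself, which is
  what independence speaks about.\<close>

lemma axial_class_fixed:
  assumes u: "axial u" and g: "g \<in> carrier G" "g \<otimes> u = u \<otimes> g"
  shows "gromov_equivalence G S `` {\<lambda>n. u [^] (n::nat)} \<in> boundary_fixed_points G S g"
proof -
  let ?E = "gromov_equivalence G S" and ?x = "\<lambda>n::nat. u [^] n"
  have trans: "(a, c) \<in> ?E" if "(a, b) \<in> ?E" "(b, c) \<in> ?E" for a b c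
    using that equiv_gromov by (meson equivE transE)
  have sym: "(b, a) \<in> ?E" if "(a, b) \<in> ?E" for a b
    using that equiv_gromov by (meson equivE symE)
  have invariant: "(?x, \<lambda>n. h \<otimes> y n) \<in> ?E"
    if "(?x, y) \<in> ?E" "h \<in> carrier G" "h \<otimes> u = u \<otimes> h" for h y
    using trans[OF sym[OF axial_powers_translate[OF u that(2,3)]]
        gromov_equivalence_translate[OF that(2,1)]] .
  have inv_g: "inv g \<in> carrier G" "inv g \<otimes> u = u \<otimes> inv g"
    using inv_commute[of g u] u g by simp_all
  have "boundary_action G g (?E `` {?x}) = ?E `` {?x}"
  proof (intro equalityI subsetI)
    fix z assume "z \<in> boundary_action G g (?E `` {?x})"
    then show "z \<in> ?E `` {?x}" using invariant g by (auto simp: boundary_action_def)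
  next
    fix z assume z: "z \<in> ?E `` {?x}"
    then have "(?x, \<lambda>n. inv g \<otimes> z n) \<in> ?E" using invariant[OF _ inv_g] by simp
    moreover have "z = (\<lambda>n. g \<otimes> (inv g \<otimes> z n))"
    proof
      fix n
      have "z n \<in> carrier G" using z by (auto simp: gromov_equivalence_iff gromov_sequences_closed)
      then show "z n = g \<otimes> (inv g \<otimes> z n)" using g by (simp add: m_assoc[symmetric])
    qed
    ultimately show "z \<in> boundary_action G g (?E `` {?x})"
      unfolding boundary_action_def by (intro image_eqI[where x = "\<lambda>n. inv g \<otimes> z n"]) simp_all
  qed
  moreover have "?E `` {?x} \<in> gromov_boundary G S"
    using axial_powers_gromov_sequence[OF u] unfolding gromov_boundary_def by (rule quotientI)
  ultimately show ?thesis by (simp add: boundary_fixed_points_def)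
qed

lemma axial_power_of_loxodromic:
  assumes "loxodromic G S g" shows "\<exists>k::nat. axial (g [^] k)"
proof -
  obtain C D where "0 < C" and g: "g \<in> carrier G"
    and qg: "quasi_geodesic G S C D UNIV (\<lambda>n. g [^] n)"
    using assms unfolding loxodromic_def by blast
  have "inverse C * real n - D \<le> wlen (g [^] n)" for n :: nat
  proof -
    have "inverse C * of_int \<bar>0 - int n\<bar> - D \<le> word_dist G S (g [^] (0::int)) (g [^] int n)"
      using qg unfolding quasi_geodesic_def by blast
    then show ?thesis using g by (simp add: word_dist_def int_pow_int)
  qed
  then show ?thesis using axial_power_of_linear_growth[OF g \<open>0 < C\<close>] by blast
qed

lemma independent_gp_bounded:
  assumes u: "axial u" "g \<in> carrier G" "g \<otimes> u = u \<otimes> g"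
    and v: "axial v" "h \<in> carrier G" "h \<otimes> v = v \<otimes> h"
    and disjoint: "boundary_fixed_points G S g \<inter> boundary_fixed_points G S h = {}"
  shows "\<exists>c. \<forall>m n. gp (u [^] (m::nat)) (v [^] (n::nat)) \<le> c"
proof (rule axial_gp_bounded)
  show "\<not> filterlim (\<lambda>n::nat. gp (u [^] n) (v [^] n)) at_top sequentially"
  proof
    assume "filterlim (\<lambda>n::nat. gp (u [^] n) (v [^] n)) at_top sequentially"
    then have "(\<lambda>n. u [^] (n::nat), \<lambda>n. v [^] (n::nat)) \<in> gromov_equivalence G S"
      using axial_powers_gromov_sequence u v by (simp add: gromov_equivalence_iff)
    then have "gromov_equivalence G S `` {\<lambda>n. u [^] (n::nat)} = gromov_equivalence G S `` {\<lambda>n. v [^] (n::nat)}"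
      by (rule equiv_class_eq[OF equiv_gromov])
    then show False
      using axial_class_fixed[OF u] axial_class_fixed[OF v] disjoint by auto
  qed
qed (use u v in auto)

text \<open>Each of the four sign choices compares a fixed point of \<open>g\<close> with one of \<open>h\<close>.\<close>

lemma independent_transverse:
  assumes "independent_loxodromics G S g h"
  shows "\<exists>u v c. axial u \<and> axial v \<and> transverse c u v \<and> 0 \<le> c"
proof -
  have gh: "g \<in> carrier G" "h \<in> carrier G"
    and lox: "loxodromic G S g" "loxodromic G S h"
    and disjoint: "boundary_fixed_points G S g \<inter> boundary_fixed_points G S h = {}"
    using assms by (auto simp: independent_loxodromics_def loxodromic_def)
  obtain k l :: nat where axial: "axial (g [^] k)" "axial (h [^] l)"
    using lox axial_power_of_loxodromic by blast
  define u where "u = g [^] k"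
  define v where "v = h [^] l"
  have axial_both: "axial x" if "x \<in> {u, inv u, v, inv v}" for x
    using that axial axial_inv by (auto simp: u_def v_def)
  have comm: "f \<otimes> f [^] k = f [^] k \<otimes> f" "f \<otimes> inv (f [^] k) = inv (f [^] k) \<otimes> f"
    if f: "f \<in> carrier G" for f and k :: nat
  proof -
    show *: "f \<otimes> f [^] k = f [^] k \<otimes> f" using f nat_pow_Suc2[of f k] by simp
    show "f \<otimes> inv (f [^] k) = inv (f [^] k) \<otimes> f"
      using inv_commute[of "f [^] k" f] f * by simp
  qed
  have "\<exists>c. \<forall>m n. gp (x [^] (m::nat)) (y [^] (n::nat)) \<le> c" if "x \<in> {u, inv u}" "y \<in> {v, inv v}" for x y
    using that gh comm axial_both
    by (intro independent_gp_bounded[of x g y h] disjoint) (auto simp: u_def v_def)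
  then obtain B where B: "gp (x [^] (m::nat)) (y [^] (n::nat)) \<le> B x y"
    if "x \<in> {u, inv u}" "y \<in> {v, inv v}" for x y m n
    by metis
  define c where "c = Max ({0} \<union> (\<lambda>(x, y). B x y) ` ({u, inv u} \<times> {v, inv v}))"
  have "B x y \<le> c" if "x \<in> {u, inv u}" "y \<in> {v, inv v}" for x y
    unfolding c_def using that by (intro Max_ge) auto
  then have bound: "gp (x [^] (m::nat)) (y [^] (n::nat)) \<le> c"
    if "x \<in> {u, inv u}" "y \<in> {v, inv v}" for x y m n
    using B[OF that, of m n] that by (meson order_trans)
  have "0 \<le> c" unfolding c_def by (intro Max_ge) auto
  moreover have "transverse c u v"
    using gh bound[of u v] bound[of "inv u" v] bound[of u "inv v"] bound[of "inv u" "inv v"]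
    by (auto simp: transverse_def nat_pow_inv[symmetric] u_def v_def)
  ultimately show ?thesis using axial u_def v_def by blast
qed

section \<open>Paths spelled by geodesic words\<close>

definition junction :: "real \<Rightarrow> 'a list \<Rightarrow> 'a list \<Rightarrow> bool"
  where "junction c p q \<longleftrightarrow> gp (inv (list_product G p)) (list_product G q) \<le> c"

lemma geodesic_word_len_append:
  assumes "geodesic_word (p @ q)"
  shows "list_product G (p @ q) = list_product G p \<otimes> list_product G q"
    "wlen (list_product G p \<otimes> list_product G q) = wlen (list_product G p) + wlen (list_product G q)"
proof -
  show eq: "list_product G (p @ q) = list_product G p \<otimes> list_product G q"
    using assms generators_closed by (simp add: geodesic_word_def list_product_append)
  show "wlen (list_product G p \<otimes> list_product G q) = wlen (list_product G p) + wlen (list_product G q)"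
    using assms geodesic_word_append[OF assms] by (simp add: geodesic_word_def eq)
qed

text \<open>Shortening a geodesic at its far end can only decrease a Gromov product, so the pieces that
  remain when a broken geodesic is cut inside a step still form small junctions.\<close>

lemma junction_prefix:
  assumes "junction c w (p @ q)" "geodesic_word w" "geodesic_word (p @ q)"
  shows "junction c w p"
  using assms geodesic_word_append[OF assms(3)] geodesic_word_len_append[OF assms(3)]
    gp_geodesic_mono[of "inv (list_product G w)" "list_product G p" "list_product G q"]
  by (simp add: junction_def geodesic_word_closed)

lemma junction_suffix:
  assumes "junction c (p @ q) w" "geodesic_word (p @ q)" "geodesic_word w"
  shows "junction c q w"
proof -
  let ?p = "list_product G p" and ?q = "list_product G q" and ?w = "list_product G w"
  have closed [simp]: "?p \<in> carrier G" "?q \<in> carrier G" "?w \<in> carrier G"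
    using assms geodesic_word_append[OF assms(2)] geodesic_word_closed by auto
  have "inv (?p \<otimes> ?q) = inv ?q \<otimes> inv ?p" by (simp add: inv_mult_group)
  moreover have "wlen (inv ?q \<otimes> inv ?p) = wlen (inv ?q) + wlen (inv ?p)"
    using geodesic_word_len_append(2)[OF assms(2)] wlen_inv[of "?p \<otimes> ?q"]
    by (simp add: inv_mult_group wlen_inv)
  ultimately have "gp ?w (inv ?q) \<le> gp ?w (inv (?p \<otimes> ?q))"
    using gp_geodesic_mono[of ?w "inv ?q" "inv ?p"] by simp
  then show ?thesis
    using assms geodesic_word_len_append(1)[OF assms(2)]
      gp_commute[of ?w "inv ?q"] gp_commute[of ?w "inv (?p \<otimes> ?q)"]
    by (simp add: junction_def)
qed

text \<open>The cut may shorten the last word that is kept, and with it the junction in front of that word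
  changes. Quantifying over a preceding word \<open>w\<close> makes this junction part of the claim, as the
  induction needs it.\<close>

lemma broken_geodesic_take:
  assumes "\<forall>x\<in>set xss. geodesic_word x"
  shows "\<exists>yss. take n (concat xss) = concat yss \<and> (\<forall>y\<in>set yss. geodesic_word y) \<and>
    set (butlast yss) \<subseteq> set xss \<and>
    (\<forall>w. geodesic_word w \<longrightarrow> successively (junction c) (w # xss) \<longrightarrow> successively (junction c) (w # yss))"
  using assms
proof (induction xss arbitrary: n)
  case Nil
  then show ?case by (intro exI[of _ "[]"]) simp
next
  case (Cons x xss)
  show ?case
  proof (cases "n \<le> length x")
    case True
    have x: "geodesic_word (take n x @ drop n x)" using Cons.prems by simp
    have "junction c w (take n x)" if "geodesic_word w" "junction c w x" for w
      using junction_prefix[of c w "take n x" "drop n x"] that x by simp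
    then show ?thesis
      using True geodesic_word_append(1)[OF x] by (intro exI[of _ "[take n x]"]) simp
  next
    case False
    obtain yss where yss: "take (n - length x) (concat xss) = concat yss" "\<forall>y\<in>set yss. geodesic_word y"
      "set (butlast yss) \<subseteq> set xss"
      "\<forall>w. geodesic_word w \<longrightarrow> successively (junction c) (w # xss) \<longrightarrow> successively (junction c) (w # yss)"
      using Cons.IH[of "n - length x"] Cons.prems by auto
    then show ?thesis
      using False Cons.prems by (intro exI[of _ "x # yss"]) auto
  qed
qed

lemma broken_geodesic_drop:
  assumes "\<forall>x\<in>set xss. geodesic_word x" "successively (junction c) xss"
  shows "\<exists>yss. drop n (concat xss) = concat yss \<and> (\<forall>y\<in>set yss. geodesic_word y) \<and>
    set (butlast (tl yss)) \<subseteq> set (butlast xss) \<and> successively (junction c) yss"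
  using assms
proof (induction xss arbitrary: n)
  case Nil
  then show ?case by (intro exI[of _ "[]"]) simp
next
  case (Cons x xss)
  show ?case
  proof (cases "n \<le> length x")
    case True
    have x: "geodesic_word (take n x @ drop n x)" using Cons.prems by simp
    have "junction c (drop n x) w" if "geodesic_word w" "junction c x w" for w
      using junction_suffix[of c "take n x" "drop n x" w] that x by simp
    then have "successively (junction c) (drop n x # xss)"
      using Cons.prems by (cases xss) auto
    then show ?thesis
      using True Cons.prems geodesic_word_append(2)[OF x] by (intro exI[of _ "drop n x # xss"]) auto
  next
    case False
    obtain yss where "drop (n - length x) (concat xss) = concat yss" "\<forall>y\<in>set yss. geodesic_word y"
      "set (butlast (tl yss)) \<subseteq> set (butlast xss)" "successively (junction c) yss"
      using Cons.IH[of "n - length x"] Cons.prems by (auto simp: successively_Cons)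
    then show ?thesis
      using False by (intro exI[of _ yss]) auto
  qed
qed

text \<open>Carries \<open>chain_length\<close> over from group elements to words; the first and the last word stand for
  the pieces left by cutting.\<close>

lemma broken_geodesic_length:
  assumes "\<forall>x\<in>set xss. geodesic_word x" "successively (junction c) xss" "0 \<le> c"
    and "\<forall>x\<in>set (butlast (tl xss)). 4 * c + 4 * \<delta> < length x"
  shows "length (concat xss) / 2 - (2 * c + 2 * \<delta>) \<le> wlen (list_product G (concat xss))"
proof (cases xss)
  case Nil
  then show ?thesis using assms delta_nonneg by (simp add: wlen_one)
next
  case (Cons x ys)
  let ?p = "list_product G"
  have geo: "real (wlen (?p y)) = length y" "set y \<subseteq> carrier G" if "y \<in> set xss" for y
    using that assms(1) generators_closed by (auto simp: geodesic_word_def)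
  have "sum_list (map (\<lambda>x. real (wlen x)) (map ?p xss)) = real (sum_list (map length xss))"
    using geo(1) by (induction xss) auto
  moreover have "?p (concat xss) = ?p (map ?p xss)" using geo(2) by (simp add: list_product_concat)
  moreover have "sum_list (map (\<lambda>x. real (wlen x)) (?p x # map ?p ys)) / 2 - (2 * c + 2 * \<delta>)
      \<le> wlen (?p (?p x # map ?p ys))"
  proof (rule chain_length)
    show "set (?p x # map ?p ys) \<subseteq> carrier G" using geo(2) Cons by (auto intro: list_product_closed)
    have "successively (\<lambda>x y. gp (inv x) y \<le> c) (map ?p xss)"
      using assms(2) by (simp add: successively_map junction_def[abs_def])
    then show "successively (\<lambda>x y. gp (inv x) y \<le> c) (?p x # map ?p ys)" using Cons by simp
    show "\<forall>v\<in>set (butlast (map ?p ys)). 4 * c + 4 * \<delta> < real (wlen v)"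
    proof
      fix v assume "v \<in> set (butlast (map ?p ys))"
      then obtain y where y: "y \<in> set (butlast ys)" "v = ?p y"
        unfolding map_butlast[symmetric] set_map by blast
      moreover have "y \<in> set xss" using in_set_butlastD[OF y(1)] Cons by simp
      ultimately show "4 * c + 4 * \<delta> < real (wlen v)" using assms(4) geo(1) Cons by simp
    qed
  qed fact
  ultimately show ?thesis using Cons by (simp add: length_concat)
qed

lemma segment_length:
  assumes xss: "\<forall>x\<in>set xss. geodesic_word x \<and> 4 * c + 4 * \<delta> < length x"
    and "successively (junction c) xss" "0 \<le> c" "m \<le> n" "n \<le> length (concat xss)"
  shows "(real n - real m) / 2 - (2 * c + 2 * \<delta>) \<le> wlen (list_product G (drop m (take n (concat xss))))"
proof -
  obtain yss where yss: "take n (concat xss) = concat yss" "\<forall>y\<in>set yss. geodesic_word y"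
    "set (butlast yss) \<subseteq> set xss"
    and extend: "\<And>w. geodesic_word w \<Longrightarrow> successively (junction c) (w # xss) \<Longrightarrow> successively (junction c) (w # yss)"
    using broken_geodesic_take[of xss n c] xss by blast
  \<comment> \<open>The empty word serves as an initial piece: its Gromov products vanish.\<close>
  have "geodesic_word []" by (simp add: geodesic_word_def wlen_one)
  moreover have "junction c [] x" if "x \<in> set xss" for x
  proof -
    have "list_product G x \<in> carrier G" using xss that geodesic_word_closed by blast
    then show ?thesis
      using \<open>0 \<le> c\<close> gp_commute[of \<one> "list_product G x"] by (simp add: junction_def)
  qed
  then have "successively (junction c) ([] # xss)" using assms(2) by (cases xss) auto
  ultimately have "successively (junction c) yss"
    using extend[of "[]"] by (auto simp: successively_Cons)
  then obtain zss where zss: "drop m (concat yss) = concat zss" "\<forall>z\<in>set zss. geodesic_word z"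
    "set (butlast (tl zss)) \<subseteq> set (butlast yss)" "successively (junction c) zss"
    using broken_geodesic_drop[of yss c m] yss(2) by blast
  have "length (concat zss) / 2 - (2 * c + 2 * \<delta>) \<le> wlen (list_product G (concat zss))"
  proof (rule broken_geodesic_length)
    show "\<forall>x\<in>set (butlast (tl zss)). 4 * c + 4 * \<delta> < length x"
      using zss(3) yss(3) xss by blast
  qed (use zss \<open>0 \<le> c\<close> in blast)+
  moreover have eq: "drop m (take n (concat xss)) = concat zss" unfolding yss(1) by (rule zss(1))
  moreover have "length (drop m (take n (concat xss))) = n - m" using assms(5) by (auto simp: min_def)
  then have "length (concat zss) = n - m" unfolding eq .
  ultimately show ?thesis using \<open>m \<le> n\<close> by (simp add: of_nat_diff)
qed

definition semigroup_span :: "'a set \<Rightarrow> 'a set"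
  where "semigroup_span A = {list_product G xs |xs. xs \<noteq> [] \<and> set xs \<subseteq> A}"

lemma semigroup_span_superset:
  assumes "A \<subseteq> carrier G" shows "A \<subseteq> semigroup_span A"
proof
  fix x assume "x \<in> A"
  then show "x \<in> semigroup_span A"
    using assms unfolding semigroup_span_def by (intro CollectI exI[of _ "[x]"]) auto
qed

lemma subsemigroup_span:
  assumes "A \<subseteq> carrier G" shows "subsemigroup G (semigroup_span A)"
  unfolding subsemigroup_def
proof (intro conjI ballI)
  show "semigroup_span A \<subseteq> carrier G"
    using assms by (auto simp: semigroup_span_def intro!: list_product_closed)
  fix x y assume "x \<in> semigroup_span A" "y \<in> semigroup_span A"
  then obtain xs ys where "x = list_product G xs" "xs \<noteq> []" "set xs \<subseteq> A"
      "y = list_product G ys" "set ys \<subseteq> A" by (auto simp: semigroup_span_def)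
  then show "x \<otimes> y \<in> semigroup_span A"
    using assms unfolding semigroup_span_def
    by (intro CollectI exI[of _ "xs @ ys"]) (auto simp: list_product_append)
qed

text \<open>Reading a word letter by letter moves at most at unit speed, so only the lower bound is at stake, and
  the distance between two times is the length of the subword read between them.\<close>

lemma quasi_geodesic_of_word:
  assumes W: "set W \<subseteq> S" and "0 \<le> E"
    and lower: "\<And>m n. m \<le> n \<Longrightarrow> n \<le> length W \<Longrightarrow>
      (real n - real m) / 2 - E \<le> wlen (list_product G (drop m (take n W)))"
  shows "quasi_geodesic G S 2 (E + 1) {0..real (length W)} (\<lambda>k. list_product G (take (nat k) W))"
proof -
  let ?x = "\<lambda>k. list_product G (take (nat k) W)"
  have sub: "set (take k W) \<subseteq> carrier G" "set (drop l (take k W)) \<subseteq> S" for k l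
    using W generators_closed by (auto dest!: in_set_takeD in_set_dropD)
  have closed: "?x k \<in> carrier G" for k using sub by simp
  have ordered: "inverse 2 * real_of_int \<bar>m - n\<bar> - (E + 1) \<le> word_dist G S (?x m) (?x n) \<and>
      word_dist G S (?x m) (?x n) \<le> 2 * real_of_int \<bar>m - n\<bar> + (E + 1)"
    if mn: "0 \<le> m" "m \<le> n" "n \<le> int (length W)" for m n
  proof -
    let ?v = "drop (nat m) (take (nat n) W)"
    have v: "set ?v \<subseteq> S" using sub by blast
    have "take (nat n) W = take (nat m) W @ ?v"
      using mn append_take_drop_id[of "nat m" "take (nat n) W"] by (simp add: min_def nat_le_iff)
    then have "?x n = ?x m \<otimes> list_product G ?v"
      using list_product_append[of "take (nat m) W" ?v] sub(1) generators_closed[OF v] by metis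
    then have "inv (?x m) \<otimes> ?x n = list_product G ?v"
      using closed[of m] generators_closed[OF v] by (simp add: m_assoc[symmetric])
    then have dist: "word_dist G S (?x m) (?x n) = wlen (list_product G ?v)" by (simp add: word_dist_def)
    have "length ?v = nat n - nat m" using mn by (auto simp: min_def)
    then have "wlen (list_product G ?v) \<le> nat n - nat m" using wlen_le_length[OF v] by simp
    then have "real (wlen (list_product G ?v)) \<le> real_of_int n - real_of_int m" using mn by linarith
    moreover have "(real (nat n) - real (nat m)) / 2 - E \<le> wlen (list_product G ?v)"
      using mn by (intro lower) auto
    moreover have "real (nat n) = real_of_int n" "real (nat m) = real_of_int m" using mn by auto
    moreover have "\<bar>m - n\<bar> = n - m" "0 \<le> real_of_int n - real_of_int m" using mn by auto
    ultimately show ?thesis unfolding dist using \<open>0 \<le> E\<close> by simp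
  qed
  show ?thesis
    unfolding quasi_geodesic_def
  proof (intro conjI allI impI)
    show "is_interval {0..real (length W)}" by (auto simp: is_interval_1)
    show "?x m \<in> carrier G" for m by (rule closed)
    fix m n assume "real_of_int m \<in> {0..real (length W)}" "real_of_int n \<in> {0..real (length W)}"
    then have *: "0 \<le> m" "m \<le> int (length W)" "0 \<le> n" "n \<le> int (length W)" by auto
    have "inverse 2 * real_of_int \<bar>m - n\<bar> - (E + 1) \<le> word_dist G S (?x m) (?x n) \<and>
        word_dist G S (?x m) (?x n) \<le> 2 * real_of_int \<bar>m - n\<bar> + (E + 1)"
    proof (cases "m \<le> n")
      case True
      then show ?thesis using ordered[of m n] * by blast
    next
      case False
      then show ?thesis
        using ordered[of n m] * word_dist_sym[OF closed closed, of m n] abs_minus_commute[of m n] by simp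
    qed
    then show "inverse 2 * real_of_int \<bar>m - n\<bar> - (E + 1) \<le> word_dist G S (?x m) (?x n)"
      "word_dist G S (?x m) (?x n) \<le> 2 * real_of_int \<bar>m - n\<bar> + (E + 1)" by blast+
  qed
qed

text \<open>The quasi-geodesic for a list of elements of the semigroup reads geodesic words for all factors
  in \<open>A\<close> one after another. It visits the partial products at distinct times because every
  factor is nontrivial. The constants do not see how the factors are grouped into elements of
  the semigroup.\<close>

lemma quasi_geodesic_semigroup_span:
  assumes A: "A \<subseteq> carrier G" and "0 \<le> c"
    and turn: "\<And>x y. x \<in> A \<Longrightarrow> y \<in> A \<Longrightarrow> gp (inv x) y \<le> c"
    and long: "\<And>x. x \<in> A \<Longrightarrow> 4 * c + 4 * \<delta> < wlen x"
  shows "quasi_geodesic_semigroup G S (semigroup_span A)"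
proof -
  have "\<forall>x\<in>A. \<exists>w. geodesic_word w \<and> list_product G w = x"
    using A exists_shortest_word unfolding geodesic_word_def by (metis subsetD)
  then obtain word where word: "\<And>x. x \<in> A \<Longrightarrow> geodesic_word (word x)"
    "\<And>x. x \<in> A \<Longrightarrow> list_product G (word x) = x" by metis
  have len_word: "4 * c + 4 * \<delta> < length (word x)" if "x \<in> A" for x
    using word[OF that] long[OF that] by (simp add: geodesic_word_def)
  have "\<forall>g\<in>semigroup_span A. \<exists>xs. xs \<noteq> [] \<and> set xs \<subseteq> A \<and> list_product G xs = g"
    unfolding semigroup_span_def by blast
  then obtain dec where dec: "\<And>g. g \<in> semigroup_span A \<Longrightarrow> dec g \<noteq> []"
    "\<And>g. g \<in> semigroup_span A \<Longrightarrow> set (dec g) \<subseteq> A"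
    "\<And>g. g \<in> semigroup_span A \<Longrightarrow> list_product G (dec g) = g" by metis
  define path where "path gs = concat (map word (concat (map dec gs)))" for gs
  have path_append: "path (gs @ hs) = path gs @ path hs" for gs hs by (simp add: path_def)
  have dec_sub: "set (concat (map dec gs)) \<subseteq> A" if "set gs \<subseteq> semigroup_span A" for gs
    using that dec(2) by auto
  have map_word: "map (list_product G) (map word xs) = xs" if "set xs \<subseteq> A" for xs
    using that word(2) by (induction xs) auto
  have word_sub: "set (concat (map word xs)) \<subseteq> S" if "set xs \<subseteq> A" for xs
    using that word(1) by (induction xs) (auto simp: geodesic_word_def)
  have path_product: "list_product G (path gs) = list_product G gs"
    if gs: "set gs \<subseteq> semigroup_span A" for gs
  proof -
    have word_closed: "set (word x) \<subseteq> carrier G" if "x \<in> A" for x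
      using word_sub[of "[x]"] that generators_closed by simp
    have "list_product G (path gs) = list_product G (map (list_product G) (map word (concat (map dec gs))))"
      unfolding path_def
    proof (rule list_product_concat, intro ballI)
      fix ys assume "ys \<in> set (map word (concat (map dec gs)))"
      then obtain x where "x \<in> set (concat (map dec gs))" "ys = word x" unfolding set_map by blast
      then show "set ys \<subseteq> carrier G" using word_closed dec_sub[OF gs] by blast
    qed
    also have "map (list_product G) (map word (concat (map dec gs))) = concat (map dec gs)"
      using dec_sub[OF gs] by (rule map_word)
    also have "list_product G \<dots> = list_product G (map (list_product G) (map dec gs))"
    proof (rule list_product_concat, intro ballI)
      fix ys assume "ys \<in> set (map dec gs)"
      then obtain g where "g \<in> set gs" "ys = dec g" by auto
      then show "set ys \<subseteq> carrier G" using dec(2)[of g] gs A by blast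
    qed
    also have "map (list_product G) (map dec gs) = gs"
      using dec(3) gs by (auto intro!: map_idI)
    finally show ?thesis .
  qed
  have path_nonempty: "path gs \<noteq> []" if gs: "gs \<noteq> []" "set gs \<subseteq> semigroup_span A" for gs
  proof -
    obtain g gs' where g: "gs = g # gs'" "g \<in> semigroup_span A" using gs by (cases gs) auto
    then obtain x xs where "dec g = x # xs" "x \<in> A" using dec(1,2)[of g] by (cases "dec g") auto
    moreover have "word x \<noteq> []" if "x \<in> A" for x
      using len_word[OF that] \<open>0 \<le> c\<close> delta_nonneg by auto
    ultimately show ?thesis using g by (simp add: path_def)
  qed
  have "\<exists>I x t. quasi_geodesic G S 2 (2 * c + 2 * \<delta> + 1) I x \<and> strict_mono_on {..length gs} t \<and>
      (\<forall>i\<le>length gs. of_int (t i) \<in> I \<and> x (t i) = list_product G (take i gs))"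
    if gs: "set gs \<subseteq> semigroup_span A" for gs
  proof (intro exI conjI allI impI)
    let ?W = "path gs"
    let ?x = "\<lambda>k. list_product G (take (nat k) ?W)"
    define t where "t i = int (length (path (take i gs)))" for i
    show "quasi_geodesic G S 2 (2 * c + 2 * \<delta> + 1) {0..real (length ?W)} ?x"
    proof (rule quasi_geodesic_of_word)
      show "set ?W \<subseteq> S" unfolding path_def by (rule word_sub[OF dec_sub[OF gs]])
      show "0 \<le> 2 * c + 2 * \<delta>" using \<open>0 \<le> c\<close> delta_nonneg by simp
      have "successively (junction c) (map word xs)" if "set xs \<subseteq> A" for xs
        using that by (induction xs rule: induct_list012) (auto simp: junction_def word(2) turn)
      then have joined: "successively (junction c) (map word (concat (map dec gs)))"
        using dec_sub[OF gs] by blast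
      show "(real n - real m) / 2 - (2 * c + 2 * \<delta>) \<le> wlen (list_product G (drop m (take n ?W)))"
        if "m \<le> n" "n \<le> length ?W" for m n
        unfolding path_def
      proof (rule segment_length)
        show "\<forall>x\<in>set (map word (concat (map dec gs))). geodesic_word x \<and> 4 * c + 4 * \<delta> < length x"
          unfolding set_map using dec_sub[OF gs] word(1) len_word by blast
        show "n \<le> length (concat (map word (concat (map dec gs))))" using that(2) unfolding path_def .
      qed (fact joined \<open>0 \<le> c\<close> that(1))+
    qed
    show "strict_mono_on {..length gs} t"
    proof (rule strict_mono_onI)
      fix i j assume ij: "i \<in> {..length gs}" "j \<in> {..length gs}" "i < j"
      have split: "take j gs = take i gs @ drop i (take j gs)"
        using ij append_take_drop_id[of i "take j gs"] by (simp add: min_def)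
      have "path (drop i (take j gs)) \<noteq> []"
        using ij gs by (intro path_nonempty) (auto dest!: in_set_dropD in_set_takeD)
      then show "t i < t j" unfolding t_def by (subst split) (simp add: path_append)
    qed
    fix i assume "i \<le> length gs"
    have W: "?W = path (take i gs) @ path (drop i gs)" by (simp add: path_append[symmetric])
    then show "of_int (t i) \<in> {0..real (length ?W)}" by (simp add: t_def)
    have "take (nat (t i)) ?W = path (take i gs)" by (subst W) (simp add: t_def)
    then show "?x (t i) = list_product G (take i gs)"
      using path_product[of "take i gs"] gs by (auto dest: in_set_takeD)
  qed
  moreover have "0 < 2 * c + 2 * \<delta> + 1" using \<open>0 \<le> c\<close> delta_nonneg by simp
  ultimately show ?thesis
    using subsemigroup_span[OF A] unfolding quasi_geodesic_semigroup_def
    by (intro conjI exI[of _ 2] exI[of _ "2 * c + 2 * \<delta> + 1"] allI impI) simp_all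
qed

text \<open>This is why the absorbing factors are taken from \<open>T\<close>: \<open>x = l\<inverse> (l x r) r\<inverse>\<close>.\<close>

lemma generate_of_absorbing:
  assumes T: "T \<subseteq> carrier G" "F \<subseteq> T"
    and absorb: "\<forall>x\<in>carrier G. \<exists>l\<in>F. \<exists>r\<in>F. l \<otimes> x \<otimes> r \<in> T"
  shows "generate G T = carrier G"
proof
  show "generate G T \<subseteq> carrier G" using T by (intro generate_incl) auto
  show "carrier G \<subseteq> generate G T"
  proof
    fix x assume x: "x \<in> carrier G"
    obtain l r where lr: "l \<in> T" "r \<in> T" "l \<otimes> x \<otimes> r \<in> T" using absorb x T by blast
    have [simp]: "l \<in> carrier G" "r \<in> carrier G" using lr T by auto
    have "inv l \<otimes> (l \<otimes> x \<otimes> r) \<otimes> inv r = inv l \<otimes> l \<otimes> x \<otimes> (r \<otimes> inv r)"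
      using x by (simp only: m_assoc m_closed inv_closed \<open>l \<in> carrier G\<close> \<open>r \<in> carrier G\<close>)
    also have "\<dots> = x" using x by simp
    finally have "x = inv l \<otimes> (l \<otimes> x \<otimes> r) \<otimes> inv r" ..
    moreover have "inv l \<otimes> (l \<otimes> x \<otimes> r) \<otimes> inv r \<in> generate G T"
      by (rule generate.eng[OF generate.eng[OF generate.inv[OF lr(1)] generate.incl[OF lr(3)]]
            generate.inv[OF lr(2)]])
    ultimately show "x \<in> generate G T" by (rule ssubst)
  qed
qed

end

theorem proposition1p9:
  fixes G :: "('a, 'b) monoid_scheme" (structure) and S :: "'a set"
  assumes "group G"
    and "finite_symmetric_generating_set G S"
    and "hyperbolic G S"
    and "non_elementary G S"
  shows "\<exists>T F L R.
    subsemigroup G T \<and>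
    F \<subseteq> carrier G \<and> finite F \<and> L \<in> carrier G \<rightarrow> F \<and> R \<in> carrier G \<rightarrow> F \<and>
    generate G T = carrier G \<and>
    quasi_geodesic_semigroup G S T \<and>
    (\<forall>\<gamma>\<in>carrier G. L \<gamma> \<otimes> \<gamma> \<otimes> R \<gamma> \<in> T)"
proof -
  interpret word_metric G S
    using assms(1,2) by (intro word_metric.intro word_metric_axioms.intro)
  obtain \<delta> where "hyperbolic_group G S \<delta>" using hyperbolic_group_of_hyperbolic[OF assms(3)] by blast
  then interpret hyperbolic_group G S \<delta> .
  obtain u v c where uv: "axial u" "axial v" "transverse c u v" "0 \<le> c"
    using assms(4) independent_transverse unfolding non_elementary_def by blast
  \<comment> \<open>Junctions in the gate have product at most \<open>c + 2 \<delta>\<close>, so a broken geodesic with steps in the gate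
    needs steps longer than \<open>4 (c + 2 \<delta>) + 4 \<delta>\<close>.\<close>
  define K where "K = 4 * c + 12 * \<delta> + 1"
  have K: "c < K" "c + 2 * \<delta> < K" "4 * (c + 2 * \<delta>) + 4 * \<delta> < K"
    using uv(4) delta_nonneg by (auto simp: K_def)
  obtain a b F where ab: "a \<in> carrier G" "b \<in> carrier G" "gp a b \<le> c"
    and F: "finite F" "F \<subseteq> gate a b K"
    and absorb: "\<forall>x\<in>carrier G. \<exists>l\<in>F. \<exists>r\<in>F. l \<otimes> x \<otimes> r \<in> gate a b K"
    using gate_absorbs[OF uv K(1)] by blast
  have gate: "gate a b K \<subseteq> carrier G" by (auto simp: gate_def)
  define T where "T = semigroup_span (gate a b K)"
  have gate_T: "gate a b K \<subseteq> T" unfolding T_def by (rule semigroup_span_superset[OF gate])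
  have sub: "subsemigroup G T" unfolding T_def by (rule subsemigroup_span[OF gate])
  have qg: "quasi_geodesic_semigroup G S T"
    unfolding T_def
  proof (rule quasi_geodesic_semigroup_span[OF gate, of "c + 2 * \<delta>"])
    show "0 \<le> c + 2 * \<delta>" using uv(4) delta_nonneg by simp
    show "gp (inv x) y \<le> c + 2 * \<delta>" if "x \<in> gate a b K" "y \<in> gate a b K" for x y
      using gate_junction[OF ab K(2)] that .
    show "4 * (c + 2 * \<delta>) + 4 * \<delta> < wlen x" if "x \<in> gate a b K" for x
      using gate_len[OF ab(1) that] K(3) by linarith
  qed
  have gen: "generate G T = carrier G"
  proof (rule generate_of_absorbing)
    show "T \<subseteq> carrier G" using sub by (simp add: subsemigroup_def)
    show "F \<subseteq> T" using F(2) gate_T by blast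
    show "\<forall>x\<in>carrier G. \<exists>l\<in>F. \<exists>r\<in>F. l \<otimes> x \<otimes> r \<in> T" using absorb gate_T by (meson subsetD)
  qed
  obtain L R where LR: "\<And>x. x \<in> carrier G \<Longrightarrow> L x \<in> F \<and> R x \<in> F \<and> L x \<otimes> x \<otimes> R x \<in> gate a b K"
    using absorb by metis
  have "L \<in> carrier G \<rightarrow> F" "R \<in> carrier G \<rightarrow> F" using LR by simp_all
  moreover have "\<forall>x\<in>carrier G. L x \<otimes> x \<otimes> R x \<in> T" using LR gate_T by blast
  moreover have "F \<subseteq> carrier G" using F(2) gate by blast
  ultimately show ?thesis
    using sub F(1) qg gen by (intro exI[of _ T] exI[of _ F] exI[of _ L] exI[of _ R] conjI)
qed

end
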